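(* Let $n\geq 2$ be a finite ordinal and let $\mathrm{K}\in\{\mathrm{RC},\mathrm{DC},\mathrm{SC}\}$. Then $\mathrm{K}_n=\mathbf{I}\,\mathrm{Ks}_n$. That is, $\mathrm{RC}_n=\mathbf{I}\,\mathrm{RCs}_n$, $\mathrm{DC}_n=\mathbf{I}\,\mathrm{DCs}_n$ and $\mathrm{SC}_n=\mathbf{I}\,\mathrm{SCs}_n$, where $\mathbf{I}\mathrm{L}$ denotes the class of all isomorphic copies of members of the class $\mathrm{L}$.
   Context: $n\ge 2$ is a finite ordinal, $n=\{0,\dots,n-1\}$. Functions compose by $(g\circ f)(x)=g(f(x))$; for a function $\psi$ and $X\subseteq \mathrm{Dom}(\psi)$, $\psi^{*}X=\{\psi(x):x\in X\}$. For $i,j\in n$, $[i/j]:n\to n$ sends $i$ to $j$ and fixes everything else; $[i,j]:n\to n$ exchanges $i$ and $j$ and fixes everything else. ABSTRACT CLASSES. Algebras have the form $\mathfrak{A}=\langle A,+,\cdot,-,0,1,c_i,d_{ij}\rangle_{i,j\in n}$ with $c_i$ unary operations and $d_{ij}$ constants. Write $s^i_ix=x$ and, for $i\ne j$, $s^i_jx=c_i(x\cdot d_{ij})$. $\mathrm{RC}_n$ is the class of all such algebras satisfying (for all elements $x,y$): (Ax0) $\langle A,+,\cdot,-,0,1\rangle$ is a Boolean algebra. (Ax1) $c_i0=0$ for each $i\in n$. (Ax2) $x\le c_ix$ for each $i\in n$. (Ax3) $c_i(x\cdot c_iy)=c_ix\cdot c_iy$ for each $i\in n$. (Ax4) $d_{ii}=1$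 for each $i\in n$. (Ax5) $d_{ik}\cdot d_{kj}\le d_{ij}=d_{ji}=c_kd_{ji}$ for each $i,j,k\in n$ with $k\ne i,j$. (Ax6) $c_i(x\cdot d_{ij})\cdot d_{ij}\le x$ for each $i,j\in n$ with $i\neq j$. (Ax7) $s^{i_m}_{j_m}c_{k_m}\cdots s^{i_1}_{j_1}c_{k_1}x\cdot\prod\{d_{l\tau(l)}:l\in K\}\le c_ix$ for each finite $m\ge1$ and all $i_1,\dots,i_m,j_1,\dots,j_m,k_1,\dots,k_m,i\in n$ such that $k_{t+1}\notin([i_t/j_t]\circ\cdots\circ[i_1/j_1])^*K$ for each $t<m$ (for $t=0$ the composition is the identity), where $\tau=[i_m/j_m]\circ\cdots\circ[i_1/j_1]$ and $K=\{i_1,\dots,i_m,k_1,\dots,k_m\}\setminus\{i\}$. $\mathrm{DC}_n$ is the class of all $\mathfrak{A}\in\mathrm{RC}_n$ satisfying (Ax8) $c_ic_jx\ge c_jc_ix\cdot d_{jk}$ for each $i,j,k\in n$ with $k\neq i,j$. (Ax9) $d_{ij}=c_k(d_{ik}\cdot d_{kj})$ for each $i,j,k\in n$ with $k\ne i,j$. (Ax10) $s^k_is^i_js^j_ms^m_kc_kx=s^k_ms^m_is^i_js^j_kc_kx$ for each $i,j,k,m\in n$ with $k\ne i,j,m$ and $m\neq i,j$. $\mathrm{SC}_2$ is the class of all $\mathfrak{A}\in\mathrm{DC}_2$ satisfying (Ax11) $x\cdot -d_{01}\le c_0c_1(-d_{01}\cdot s^0_1c_1x\cdot s^1_0c_0x)$.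 For $n\ge3$, $\mathrm{SC}_n$ is the class of all $\mathfrak{A}\in\mathrm{DC}_n$ satisfying (Ax12) $x\le c_ic_j\big(s^i_jc_jx\cdot s^j_ic_ix\cdot\prod_{k\in n,\,k\ne i,j}s^k_is^i_js^j_kc_kx\big)$ for each $i,j\in n$. CONCRETE CLASSES. For sequences $f,g$ of length $n$ and $i\in n$, $g\equiv_i f$ means that $f$ and $g$ agree except possibly at $i$. For a set $V$ of sequences of length $n$ and $X\subseteq V$ put $C_i^{[V]}X=\{f\in V:(\exists g\in X)\,f\equiv_ig\}$ and $D_{ij}^{[V]}=\{f\in V:f(i)=f(j)\}$, and let $\mathfrak{P}(V)=\langle\mathcal{P}(V),\cup,\cap,\setminus,\emptyset,V,C_i^{[V]},D_{ij}^{[V]}\rangle_{i,j\in n}$, where $\mathcal P(V)$ is the family of all subsets of $V$ and $\setminus$ is complementation relative to $V$. $\mathrm{RCs}_n$ is the class of all subalgebras of algebras of the form $\mathfrak{P}(V)$, with $V$ a non-empty set of sequences of length $n$; $V$ is the unit of such a subalgebra. $\mathrm{DCs}_n$ is the class of all $\mathfrak{A}\in\mathrm{RCs}_n$ whose unit $V$ is diagonalizable: $f\circ[i/j]\in V$ for all $f\in V$, $i,j\in n$. $\mathrm{SCs}_n$ is the class of all $\mathfrak{A}\in\mathrm{DCs}_n$ whose unit $V$ is permutable: $f\circ[i,j]\in V$ for all $f\in V$, $i,j\in n$.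
   Formalization: Boolean algebras in (Ax0) are taken with 0≠1, and in (Ax5) d_ij=d_ji is required for all i,j even when no k≠i,j exists (matters only for RC_2); without these the one-element algebra and a two-element algebra with d_01=1, d_10=0 are counterexamples. *)

theory Defs
  imports Main "HOL-Library.FuncSet" "HOL-Combinatorics.Transposition"
begin

record 'a cyl_alg =
  carrier :: "'a set"
  join :: "'a \<Rightarrow> 'a \<Rightarrow> 'a"
  meet :: "'a \<Rightarrow> 'a \<Rightarrow> 'a"
  compl :: "'a \<Rightarrow> 'a"
  zero :: 'a
  one :: 'a
  cyl :: "nat \<Rightarrow> 'a \<Rightarrow> 'a"
  diag :: "nat \<Rightarrow> nat \<Rightarrow> 'a"

text \<open>The fields \<open>cyl\<close> and \<open>diag\<close> are relevant only for indices below the dimension, and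
  all operations only on the carrier.\<close>

definition algebra :: "nat \<Rightarrow> ('a, 'm) cyl_alg_scheme \<Rightarrow> bool" where
  "algebra n A \<longleftrightarrow>
     zero A \<in> carrier A \<and> one A \<in> carrier A \<and>
     (\<forall>x\<in>carrier A. \<forall>y\<in>carrier A. join A x y \<in> carrier A \<and> meet A x y \<in> carrier A) \<and>
     (\<forall>x\<in>carrier A. compl A x \<in> carrier A) \<and>
     (\<forall>i<n. \<forall>x\<in>carrier A. cyl A i x \<in> carrier A) \<and>
     (\<forall>i<n. \<forall>j<n. diag A i j \<in> carrier A)"

definition isomorphic ::
    "nat \<Rightarrow> ('a, 'm) cyl_alg_scheme \<Rightarrow> ('b, 'k) cyl_alg_scheme \<Rightarrow> bool" where
  "isomorphic n A B \<longleftrightarrow> (\<exists>h. bij_betw h (carrier A) (carrier B) \<and>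
     h (zero A) = zero B \<and> h (one A) = one B \<and>
     (\<forall>x\<in>carrier A. \<forall>y\<in>carrier A.
        h (join A x y) = join B (h x) (h y) \<and> h (meet A x y) = meet B (h x) (h y)) \<and>
     (\<forall>x\<in>carrier A. h (compl A x) = compl B (h x)) \<and>
     (\<forall>i<n. \<forall>x\<in>carrier A. h (cyl A i x) = cyl B i (h x)) \<and>
     (\<forall>i<n. \<forall>j<n. h (diag A i j) = diag B i j))"

definition iso_copies :: "nat \<Rightarrow> 'b cyl_alg set \<Rightarrow> 'a cyl_alg set" where
  "iso_copies n L = {A. algebra n A \<and> (\<exists>B\<in>L. isomorphic n A B)}"

definition subalgebra :: "nat \<Rightarrow> 'a cyl_alg \<Rightarrow> 'a cyl_alg \<Rightarrow> bool" where
  "subalgebra n B A \<longleftrightarrow>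
     (\<exists>X. X \<subseteq> carrier A \<and> B = A\<lparr>carrier := X\<rparr> \<and> algebra n B)"

definition leq :: "('a, 'm) cyl_alg_scheme \<Rightarrow> 'a \<Rightarrow> 'a \<Rightarrow> bool" where
  "leq A x y \<longleftrightarrow> meet A x y = x"

text \<open>Finite products, indexed by a finite set of natural numbers; the empty product is 1.
  By associativity and commutativity of the meet the order of the factors is irrelevant.\<close>

definition big_meet :: "('a, 'm) cyl_alg_scheme \<Rightarrow> (nat \<Rightarrow> 'a) \<Rightarrow> nat set \<Rightarrow> 'a" where
  "big_meet A f K = foldr (\<lambda>l y. meet A (f l) y) (sorted_list_of_set K) (one A)"

text \<open>\<open>sub A i j\<close> is the operation \<open>s\<close> with upper index \<open>i\<close> and lower index \<open>j\<close>.\<close>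

definition sub :: "('a, 'm) cyl_alg_scheme \<Rightarrow> nat \<Rightarrow> nat \<Rightarrow> 'a \<Rightarrow> 'a" where
  "sub A i j x = (if i = j then x else cyl A i (meet A x (diag A i j)))"

definition repl :: "nat \<Rightarrow> nat \<Rightarrow> nat \<Rightarrow> nat" where
  "repl i j = id(i := j)"

text \<open>Boolean algebras are required to be non-degenerate. Units of set algebras are non-empty,
  so a one-element algebra is not isomorphic to any set algebra, although it satisfies all the
  equations below.\<close>

definition ax0 :: "'a cyl_alg \<Rightarrow> bool" where
  "ax0 A \<longleftrightarrow>
     zero A \<noteq> one A \<and>
     (\<forall>x\<in>carrier A. \<forall>y\<in>carrier A. \<forall>z\<in>carrier A.
        join A (join A x y) z = join A x (join A y z) \<and>
        meet A (meet A x y) z = meet A x (meet A y z) \<and>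
        meet A x (join A y z) = join A (meet A x y) (meet A x z) \<and>
        join A x (meet A y z) = meet A (join A x y) (join A x z)) \<and>
     (\<forall>x\<in>carrier A. \<forall>y\<in>carrier A.
        join A x y = join A y x \<and> meet A x y = meet A y x \<and>
        join A x (meet A x y) = x \<and> meet A x (join A x y) = x) \<and>
     (\<forall>x\<in>carrier A.
        join A x (zero A) = x \<and> meet A x (one A) = x \<and>
        join A x (compl A x) = one A \<and> meet A x (compl A x) = zero A)"

definition ax1 :: "nat \<Rightarrow> 'a cyl_alg \<Rightarrow> bool" where
  "ax1 n A \<longleftrightarrow> (\<forall>i<n. cyl A i (zero A) = zero A)"

definition ax2 :: "nat \<Rightarrow> 'a cyl_alg \<Rightarrow> bool" where
  "ax2 n A \<longleftrightarrow> (\<forall>i<n. \<forall>x\<in>carrier A. leq A x (cyl A i x))"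

definition ax3 :: "nat \<Rightarrow> 'a cyl_alg \<Rightarrow> bool" where
  "ax3 n A \<longleftrightarrow> (\<forall>i<n. \<forall>x\<in>carrier A. \<forall>y\<in>carrier A.
     cyl A i (meet A x (cyl A i y)) = meet A (cyl A i x) (cyl A i y))"

definition ax4 :: "nat \<Rightarrow> 'a cyl_alg \<Rightarrow> bool" where
  "ax4 n A \<longleftrightarrow> (\<forall>i<n. diag A i i = one A)"

text \<open>The symmetry \<open>diag A i j = diag A j i\<close> is required without reference to a third index.
  For \<open>n \<ge> 3\<close> this makes no difference. For \<open>n = 2\<close> and \<open>i \<noteq> j\<close> there is no \<open>k\<close> different
  from both, and symmetry does not follow from the other axioms of \<open>RC\<close>: the two-element algebra
  with identity cylindrifications, \<open>diag 0 1 = 1\<close> and \<open>diag 1 0 = 0\<close> would be a non-representable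
  member of \<open>RC 2\<close>.\<close>

definition ax5 :: "nat \<Rightarrow> 'a cyl_alg \<Rightarrow> bool" where
  "ax5 n A \<longleftrightarrow>
     (\<forall>i<n. \<forall>j<n. diag A i j = diag A j i) \<and>
     (\<forall>i<n. \<forall>j<n. \<forall>k<n. k \<noteq> i \<longrightarrow> k \<noteq> j \<longrightarrow>
        leq A (meet A (diag A i k) (diag A k j)) (diag A i j) \<and>
        diag A j i = cyl A k (diag A j i))"

definition ax6 :: "nat \<Rightarrow> 'a cyl_alg \<Rightarrow> bool" where
  "ax6 n A \<longleftrightarrow> (\<forall>i<n. \<forall>j<n. i \<noteq> j \<longrightarrow> (\<forall>x\<in>carrier A.
     leq A (meet A (cyl A i (meet A x (diag A i j))) (diag A i j)) x))"

text \<open>In the following, sequences \<open>i_1,...,i_m\<close>, \<open>j_1,...,j_m\<close>, \<open>k_1,...,k_m\<close> are given by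
  functions \<open>p\<close>, \<open>q\<close>, \<open>r\<close>, of which only the values at \<open>1,...,m\<close> are used. The innermost
  operations of a word, and the rightmost factors of the composition, have index 1.\<close>

primrec word ::
    "'a cyl_alg \<Rightarrow> (nat \<Rightarrow> nat) \<Rightarrow> (nat \<Rightarrow> nat) \<Rightarrow> (nat \<Rightarrow> nat) \<Rightarrow> nat \<Rightarrow> 'a \<Rightarrow> 'a" where
  "word A p q r 0 x = x"
| "word A p q r (Suc t) x =
     sub A (p (Suc t)) (q (Suc t)) (cyl A (r (Suc t)) (word A p q r t x))"

primrec comp_repl :: "(nat \<Rightarrow> nat) \<Rightarrow> (nat \<Rightarrow> nat) \<Rightarrow> nat \<Rightarrow> nat \<Rightarrow> nat" where
  "comp_repl p q 0 = id"
| "comp_repl p q (Suc t) = repl (p (Suc t)) (q (Suc t)) \<circ> comp_repl p q t"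

definition ax7 :: "nat \<Rightarrow> 'a cyl_alg \<Rightarrow> bool" where
  "ax7 n A \<longleftrightarrow> (\<forall>m\<ge>1. \<forall>p q r. \<forall>i<n. \<forall>K.
     (\<forall>t\<in>{1..m}. p t < n \<and> q t < n \<and> r t < n) \<longrightarrow>
     K = (p ` {1..m} \<union> r ` {1..m}) - {i} \<longrightarrow>
     (\<forall>t<m. r (Suc t) \<notin> comp_repl p q t ` K) \<longrightarrow>
     (\<forall>x\<in>carrier A.
        leq A (meet A (word A p q r m x) (big_meet A (\<lambda>l. diag A l (comp_repl p q m l)) K))
          (cyl A i x)))"

definition RC :: "nat \<Rightarrow> 'a cyl_alg set" where
  "RC n = {A. algebra n A \<and> ax0 A \<and> ax1 n A \<and> ax2 n A \<and> ax3 n A \<and> ax4 n A \<and> ax5 n A \<and>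
     ax6 n A \<and> ax7 n A}"

definition ax8 :: "nat \<Rightarrow> 'a cyl_alg \<Rightarrow> bool" where
  "ax8 n A \<longleftrightarrow> (\<forall>i<n. \<forall>j<n. \<forall>k<n. k \<noteq> i \<longrightarrow> k \<noteq> j \<longrightarrow> (\<forall>x\<in>carrier A.
     leq A (meet A (cyl A j (cyl A i x)) (diag A j k)) (cyl A i (cyl A j x))))"

definition ax9 :: "nat \<Rightarrow> 'a cyl_alg \<Rightarrow> bool" where
  "ax9 n A \<longleftrightarrow> (\<forall>i<n. \<forall>j<n. \<forall>k<n. k \<noteq> i \<longrightarrow> k \<noteq> j \<longrightarrow>
     diag A i j = cyl A k (meet A (diag A i k) (diag A k j)))"

definition ax10 :: "nat \<Rightarrow> 'a cyl_alg \<Rightarrow> bool" where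
  "ax10 n A \<longleftrightarrow> (\<forall>i<n. \<forall>j<n. \<forall>k<n. \<forall>m<n.
     k \<noteq> i \<longrightarrow> k \<noteq> j \<longrightarrow> k \<noteq> m \<longrightarrow> m \<noteq> i \<longrightarrow> m \<noteq> j \<longrightarrow> (\<forall>x\<in>carrier A.
       sub A k i (sub A i j (sub A j m (sub A m k (cyl A k x)))) =
       sub A k m (sub A m i (sub A i j (sub A j k (cyl A k x))))))"

definition DC :: "nat \<Rightarrow> 'a cyl_alg set" where
  "DC n = {A \<in> RC n. ax8 n A \<and> ax9 n A \<and> ax10 n A}"

definition ax11 :: "'a cyl_alg \<Rightarrow> bool" where
  "ax11 A \<longleftrightarrow> (\<forall>x\<in>carrier A.
     leq A (meet A x (compl A (diag A 0 1)))
       (cyl A 0 (cyl A 1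
         (meet A (meet A (compl A (diag A 0 1)) (sub A 0 1 (cyl A 1 x)))
           (sub A 1 0 (cyl A 0 x))))))"

definition ax12 :: "nat \<Rightarrow> 'a cyl_alg \<Rightarrow> bool" where
  "ax12 n A \<longleftrightarrow> (\<forall>i<n. \<forall>j<n. \<forall>x\<in>carrier A.
     leq A x
       (cyl A i (cyl A j
         (meet A (meet A (sub A i j (cyl A j x)) (sub A j i (cyl A i x)))
           (big_meet A (\<lambda>k. sub A k i (sub A i j (sub A j k (cyl A k x))))
             ({..<n} - {i, j}))))))"

definition SC :: "nat \<Rightarrow> 'a cyl_alg set" where
  "SC n = {A \<in> DC n. if n = 2 then ax11 A else ax12 n A}"

text \<open>A sequence of length \<open>n\<close> over \<open>'u\<close> is an element of \<open>{..<n} \<rightarrow>\<^sub>E UNIV\<close>. Composition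
  with \<open>repl i j\<close> or \<open>transpose i j\<close> for \<open>i, j < n\<close> does not lead out of this set.\<close>

definition agree_off :: "nat \<Rightarrow> nat \<Rightarrow> (nat \<Rightarrow> 'u) \<Rightarrow> (nat \<Rightarrow> 'u) \<Rightarrow> bool" where
  "agree_off n i g f \<longleftrightarrow> (\<forall>j<n. j \<noteq> i \<longrightarrow> g j = f j)"

definition full_alg :: "nat \<Rightarrow> (nat \<Rightarrow> 'u) set \<Rightarrow> (nat \<Rightarrow> 'u) set cyl_alg" where
  "full_alg n V =
     \<lparr>carrier = Pow V, join = (\<union>), meet = (\<inter>), compl = (\<lambda>X. V - X), zero = {}, one = V,
      cyl = (\<lambda>i X. {f \<in> V. \<exists>g\<in>X. agree_off n i f g}),
      diag = (\<lambda>i j. {f \<in> V. f i = f j})\<rparr>"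

definition diagonalizable :: "nat \<Rightarrow> (nat \<Rightarrow> 'u) set \<Rightarrow> bool" where
  "diagonalizable n V \<longleftrightarrow> (\<forall>f\<in>V. \<forall>i<n. \<forall>j<n. f \<circ> repl i j \<in> V)"

definition permutable :: "nat \<Rightarrow> (nat \<Rightarrow> 'u) set \<Rightarrow> bool" where
  "permutable n V \<longleftrightarrow> (\<forall>f\<in>V. \<forall>i<n. \<forall>j<n. f \<circ> transpose i j \<in> V)"

definition RCs :: "nat \<Rightarrow> (nat \<Rightarrow> 'u) set cyl_alg set" where
  "RCs n = {B. \<exists>V. V \<noteq> {} \<and> V \<subseteq> ({..<n} \<rightarrow>\<^sub>E UNIV) \<and> subalgebra n B (full_alg n V)}"

definition DCs :: "nat \<Rightarrow> (nat \<Rightarrow> 'u) set cyl_alg set" where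
  "DCs n = {B \<in> RCs n. diagonalizable n (one B)}"

definition SCs :: "nat \<Rightarrow> (nat \<Rightarrow> 'u) set cyl_alg set" where
  "SCs n = {B \<in> DCs n. permutable n (one B)}"

text \<open>The classes of set algebras admit arbitrary base sets, whereas a single term can only range
  over base sets within one type. Algebras with elements in \<open>'a\<close> are therefore represented over a
  base type that depends on \<open>'a\<close>: it is infinite and at least as large as the set of all subsets
  of \<open>'a\<close>, so it has room for sequences built from ultrafilters of the algebra.\<close>

type_synonym 'a base = "('a set \<times> nat) list"

type_synonym 'u set_alg = "(nat \<Rightarrow> 'u) set cyl_alg"

end

theory Submission
  imports Defs "HOL-Combinatorics.Permutations" "HOL-Library.Countable_Set"
begin

text \<open>
  The inclusions from right to left are pointwise computations: an algebra isomorphic to a subalgebra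
  of a full set algebra with unit \<open>V\<close> has an injective homomorphism into the power set of \<open>V\<close>
  (predicate \<open>represents\<close>), so every axiom becomes a statement about sequences in \<open>V\<close>. In (Ax7), a
  word describes a walk through \<open>V\<close>, and its side condition says that the entries at the places in \<open>K\<close>
  survive the walk.

  For the other inclusions the three classes are represented by one construction from ultrafilters.
  Call ultrafilters \<open>a\<close>, \<open>b\<close> near at \<open>i\<close> if \<open>c\<^sub>i x \<in> b\<close> for all \<open>x \<in> a\<close>. It suffices to
  find a set \<open>V\<close> of sequences and a label, an ultrafilter, for each \<open>f \<in> V\<close> such that

    \<^item> \<open>f i = f j\<close> iff \<open>d\<^sub>i\<^sub>j\<close> belongs to the label of \<open>f\<close>,
    \<^item> sequences that agree off \<open>i\<close> have labels that are near at \<open>i\<close>,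
    \<^item> for every \<open>f \<in> V\<close>, each ultrafilter near at \<open>i\<close> to its label labels some \<open>g \<in> V\<close> that
      agrees with \<open>f\<close> off \<open>i\<close>,
    \<^item> every ultrafilter occurs as a label;

  then \<open>x\<close> is represented by the set of all \<open>f\<close> whose label contains \<open>x\<close> (lemma
  \<open>unit_represents\<close>). Such a \<open>V\<close> is generated freely: each ultrafilter gets its own initial sequence,
  and the third condition is met by changing one entry, where the new entry is copied if the diagonals in the
  new label demand it and is otherwise a fresh element, coded by the whole history of the sequence.

  The second condition, together with its consequence that labels are well defined, is the heart of the matter.
  Fresh elements make \<open>V\<close> tree-like, so a sequence that agrees off \<open>i\<close> with \<open>f\<close> is reached from
  \<open>f\<close> by a walk along which the entries of \<open>f\<close> at the places other than \<open>i\<close> are never lost. They can only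
  be moved from place to place, along diagonals. Recording where each of them currently stands turns the walk into
  a word admissible in (Ax7), which yields nearness at \<open>i\<close> (lemmas \<open>track_near\<close>, \<open>flow_between\<close>,
  \<open>near_if_agree\<close>).

  For DC the same construction works, since (Ax9) gives \<open>c\<^sub>i d\<^sub>i\<^sub>j = 1\<close>, and the third condition
  then closes \<open>V\<close> under the replacements \<open>[i/j]\<close>. For SC, \<open>V\<close> must also contain \<open>f \<circ> \<pi>\<close> for all
  permutations \<open>\<pi>\<close>. (Ax11) or (Ax12) provides an ultrafilter that can label \<open>f \<circ> [i,j]\<close>: it is linked to the
  label of \<open>f\<close> by short chains of near ultrafilters, one for every place that may be sacrificed as a buffer while
  two entries are exchanged (definition \<open>swap\<close>). So exchanging entries can be tracked by words as well. Labels of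
  \<open>f \<circ> \<pi>\<close> are fixed once for every ultrafilter and \<open>\<pi>\<close>, and one lets every step of the construction be
  preceded by a permutation. RC and DC are the case where the only permutation is the identity.
\<close>

section \<open>Set algebras as homomorphic images\<close>
definition represents ::
    "nat \<Rightarrow> 'a cyl_alg \<Rightarrow> (nat \<Rightarrow> 'u) set \<Rightarrow> ('a \<Rightarrow> (nat \<Rightarrow> 'u) set) \<Rightarrow> bool" where
  "represents n A V h \<longleftrightarrow> inj_on h (carrier A) \<and> h ` carrier A \<subseteq> Pow V \<and>
     h (zero A) = {} \<and> h (one A) = V \<and>
     (\<forall>x\<in>carrier A. \<forall>y\<in>carrier A.
        h (join A x y) = h x \<union> h y \<and> h (meet A x y) = h x \<inter> h y) \<and>
     (\<forall>x\<in>carrier A. h (compl A x) = V - h x) \<and>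
     (\<forall>i<n. \<forall>x\<in>carrier A. h (cyl A i x) = {f \<in> V. \<exists>g\<in>h x. agree_off n i f g}) \<and>
     (\<forall>i<n. \<forall>j<n. h (diag A i j) = {f \<in> V. f i = f j})"

text \<open>A subalgebra of a full set algebra is determined by its carrier. So being isomorphic to one is the same as having
an injective homomorphism into it. The parameter \<open>Q\<close> covers the three classes of units at once.\<close>
lemma iso_copies_iff_represents:
  fixes A :: "'a cyl_alg" and Q :: "(nat \<Rightarrow> 'u) set \<Rightarrow> bool"
  shows "A \<in> iso_copies n {B \<in> RCs n. Q (one B)} \<longleftrightarrow>
    algebra n A \<and> (\<exists>V h. V \<noteq> {} \<and> V \<subseteq> {..<n} \<rightarrow>\<^sub>E UNIV \<and> Q V \<and> represents n A V h)"
    (is "?L \<longleftrightarrow> ?R")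
proof
  assume ?L
  then obtain B :: "(nat \<Rightarrow> 'u) set cyl_alg"
    where alg: "algebra n A" and B: "B \<in> RCs n" "Q (one B)" and iso: "isomorphic n A B"
    by (auto simp: iso_copies_def)
  obtain V X where V: "V \<noteq> {}" "V \<subseteq> {..<n} \<rightarrow>\<^sub>E UNIV" and X: "X \<subseteq> Pow V"
    and B_eq: "B = (full_alg n V)\<lparr>carrier := X\<rparr>"
    using B(1) by (auto simp: RCs_def subalgebra_def full_alg_def)
  obtain h where "bij_betw h (carrier A) X"
    and h: "h (zero A) = zero B \<and> h (one A) = one B \<and>
     (\<forall>x\<in>carrier A. \<forall>y\<in>carrier A.
        h (join A x y) = join B (h x) (h y) \<and> h (meet A x y) = meet B (h x) (h y)) \<and>
     (\<forall>x\<in>carrier A. h (compl A x) = compl B (h x)) \<and>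
     (\<forall>i<n. \<forall>x\<in>carrier A. h (cyl A i x) = cyl B i (h x)) \<and>
     (\<forall>i<n. \<forall>j<n. h (diag A i j) = diag B i j)"
    using iso unfolding isomorphic_def B_eq by auto
  then have "inj_on h (carrier A)" "h ` carrier A \<subseteq> Pow V"
    using X by (auto simp: bij_betw_def)
  moreover have "one B = V" by (simp add: B_eq full_alg_def)
  ultimately have "represents n A V h" "Q V"
    using h B(2) unfolding represents_def B_eq full_alg_def by simp_all
  then show ?R using alg V by blast
next
  assume ?R
  then obtain V h where alg: "algebra n A" and V: "V \<noteq> {}" "V \<subseteq> {..<n} \<rightarrow>\<^sub>E UNIV" "Q V"
    and rep: "represents n A V h" by blast
  define B where "B = (full_alg n V)\<lparr>carrier := h ` carrier A\<rparr>"
  have sub: "h ` carrier A \<subseteq> Pow V" and inj: "inj_on h (carrier A)"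
    using rep by (auto simp: represents_def)
  have hom: "h (zero A) = zero B" "h (one A) = one B"
     "\<And>x y. x \<in> carrier A \<Longrightarrow> y \<in> carrier A \<Longrightarrow> h (join A x y) = join B (h x) (h y)"
     "\<And>x y. x \<in> carrier A \<Longrightarrow> y \<in> carrier A \<Longrightarrow> h (meet A x y) = meet B (h x) (h y)"
     "\<And>x. x \<in> carrier A \<Longrightarrow> h (compl A x) = compl B (h x)"
     "\<And>i x. i < n \<Longrightarrow> x \<in> carrier A \<Longrightarrow> h (cyl A i x) = cyl B i (h x)"
     "\<And>i j. i < n \<Longrightarrow> j < n \<Longrightarrow> h (diag A i j) = diag B i j"
    using rep unfolding represents_def B_def full_alg_def by simp_all
  have carrier_B: "carrier B = h ` carrier A" by (simp add: B_def)
  have "algebra n B"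
    using alg unfolding algebra_def carrier_B by (auto simp flip: hom)
  then have "subalgebra n B (full_alg n V)"
    unfolding subalgebra_def using sub by (auto simp: B_def full_alg_def)
  then have "B \<in> RCs n" unfolding RCs_def using V by blast
  moreover have "one B = V" by (simp add: B_def full_alg_def)
  moreover have "isomorphic n A B"
    unfolding isomorphic_def carrier_B
    by (intro exI[of _ h]) (use inj hom in \<open>auto simp: bij_betw_def\<close>)
  ultimately show ?L using alg V by (auto simp: iso_copies_def)
qed

lemma iso_copies_RCs_iff:
  "A \<in> iso_copies n (RCs n :: 'u set_alg set) \<longleftrightarrow> algebra n A \<and>
    (\<exists>(V :: (nat \<Rightarrow> 'u) set) h. V \<noteq> {} \<and> V \<subseteq> {..<n} \<rightarrow>\<^sub>E UNIV \<and> represents n A V h)"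
  using iso_copies_iff_represents[of A n "\<lambda>V :: (nat \<Rightarrow> 'u) set. True"] by simp

lemma iso_copies_DCs_iff:
  "A \<in> iso_copies n (DCs n :: 'u set_alg set) \<longleftrightarrow> algebra n A \<and>
    (\<exists>(V :: (nat \<Rightarrow> 'u) set) h. V \<noteq> {} \<and> V \<subseteq> {..<n} \<rightarrow>\<^sub>E UNIV \<and> diagonalizable n V \<and>
      represents n A V h)"
  unfolding DCs_def by (rule iso_copies_iff_represents)

lemma iso_copies_SCs_iff:
  "A \<in> iso_copies n (SCs n :: 'u set_alg set) \<longleftrightarrow> algebra n A \<and>
    (\<exists>(V :: (nat \<Rightarrow> 'u) set) h. V \<noteq> {} \<and> V \<subseteq> {..<n} \<rightarrow>\<^sub>E UNIV \<and>
      (diagonalizable n V \<and> permutable n V) \<and> represents n A V h)"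
proof -
  have "(SCs n :: 'u set_alg set) = {B \<in> RCs n. diagonalizable n (one B) \<and> permutable n (one B)}"
    by (auto simp: SCs_def DCs_def)
  then show ?thesis
    using iso_copies_iff_represents[of A n "\<lambda>V :: (nat \<Rightarrow> 'u) set. diagonalizable n V \<and> permutable n V"]
    by simp
qed

section \<open>Axioms of represented algebras\<close>
lemma agree_off_refl: "agree_off n i f f"
  by (simp add: agree_off_def)

lemma agree_off_sym: "agree_off n i f g \<Longrightarrow> agree_off n i g f"
  by (simp add: agree_off_def)

lemma agree_off_trans: "agree_off n i f g \<Longrightarrow> agree_off n i g u \<Longrightarrow> agree_off n i f u"
  by (simp add: agree_off_def)

locale represented =
  fixes n :: nat and A :: "'a cyl_alg" and V :: "(nat \<Rightarrow> 'u) set"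
    and h :: "'a \<Rightarrow> (nat \<Rightarrow> 'u) set"
  assumes alg: "algebra n A" and unit_nonempty: "V \<noteq> {}"
    and unit_ext: "V \<subseteq> {..<n} \<rightarrow>\<^sub>E UNIV" and rep: "represents n A V h"
begin

lemma closed [simp]:
  "zero A \<in> carrier A" "one A \<in> carrier A"
  "x \<in> carrier A \<Longrightarrow> y \<in> carrier A \<Longrightarrow> join A x y \<in> carrier A"
  "x \<in> carrier A \<Longrightarrow> y \<in> carrier A \<Longrightarrow> meet A x y \<in> carrier A"
  "x \<in> carrier A \<Longrightarrow> compl A x \<in> carrier A"
  "i < n \<Longrightarrow> x \<in> carrier A \<Longrightarrow> cyl A i x \<in> carrier A"
  "i < n \<Longrightarrow> j < n \<Longrightarrow> diag A i j \<in> carrier A"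
  using alg by (auto simp: algebra_def)

lemma hom [simp]:
  "h (zero A) = {}" "h (one A) = V"
  "x \<in> carrier A \<Longrightarrow> y \<in> carrier A \<Longrightarrow> h (join A x y) = h x \<union> h y"
  "x \<in> carrier A \<Longrightarrow> y \<in> carrier A \<Longrightarrow> h (meet A x y) = h x \<inter> h y"
  "x \<in> carrier A \<Longrightarrow> h (compl A x) = V - h x"
  "i < n \<Longrightarrow> x \<in> carrier A \<Longrightarrow> h (cyl A i x) = {f \<in> V. \<exists>g\<in>h x. agree_off n i f g}"
  "i < n \<Longrightarrow> j < n \<Longrightarrow> h (diag A i j) = {f \<in> V. f i = f j}"
  using rep by (simp_all add: represents_def)

lemma image_subset: "x \<in> carrier A \<Longrightarrow> h x \<subseteq> V"
  using rep by (auto simp: represents_def)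

lemma eq_iff: "x \<in> carrier A \<Longrightarrow> y \<in> carrier A \<Longrightarrow> x = y \<longleftrightarrow> h x = h y"
  using rep unfolding represents_def inj_on_def by metis

lemma leq_iff [simp]: "x \<in> carrier A \<Longrightarrow> y \<in> carrier A \<Longrightarrow> leq A x y \<longleftrightarrow> h x \<subseteq> h y"
  by (auto simp: leq_def eq_iff)

lemma sub_closed [simp]:
  "i < n \<Longrightarrow> j < n \<Longrightarrow> x \<in> carrier A \<Longrightarrow> sub A i j x \<in> carrier A"
  by (simp add: sub_def)

lemma unit_eqI:
  assumes "f \<in> V" "g \<in> V" "\<And>k. k < n \<Longrightarrow> f k = g k"
  shows "f = g"
proof (rule PiE_ext)
  show "f \<in> {..<n} \<rightarrow>\<^sub>E UNIV" "g \<in> {..<n} \<rightarrow>\<^sub>E UNIV" using assms unit_ext by blast+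
qed (use assms in simp)

lemma big_meet_rep:
  assumes "finite K" "\<And>l. l \<in> K \<Longrightarrow> F l \<in> carrier A"
  shows "big_meet A F K \<in> carrier A" "h (big_meet A F K) = {f \<in> V. \<forall>l\<in>K. f \<in> h (F l)}"
proof -
  have "foldr (\<lambda>l y. meet A (F l) y) ls (one A) \<in> carrier A \<and>
      h (foldr (\<lambda>l y. meet A (F l) y) ls (one A)) = {f \<in> V. \<forall>l\<in>set ls. f \<in> h (F l)}"
    if "\<And>l. l \<in> set ls \<Longrightarrow> F l \<in> carrier A" for ls
    using that by (induction ls) auto
  from this[of "sorted_list_of_set K"] assms
  show "big_meet A F K \<in> carrier A" "h (big_meet A F K) = {f \<in> V. \<forall>l\<in>K. f \<in> h (F l)}"
    by (simp_all add: big_meet_def)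
qed

lemma axioms_0_to_6: "ax0 A" "ax1 n A" "ax2 n A" "ax3 n A" "ax4 n A" "ax5 n A" "ax6 n A"
proof -
  show "ax0 A"
    unfolding ax0_def using unit_nonempty image_subset by (simp add: eq_iff) blast
  show "ax1 n A" by (simp add: ax1_def eq_iff)
  show "ax2 n A" using image_subset by (fastforce simp: ax2_def agree_off_def)
  show "ax3 n A"
    unfolding ax3_def
  proof (intro allI impI ballI)
    fix i x y assume i: "i < n" and xy: "x \<in> carrier A" "y \<in> carrier A"
    have "{f \<in> V. \<exists>g\<in>h x \<inter> {f \<in> V. \<exists>g\<in>h y. agree_off n i f g}. agree_off n i f g} =
        {f \<in> V. \<exists>g\<in>h x. agree_off n i f g} \<inter> {f \<in> V. \<exists>g\<in>h y. agree_off n i f g}"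
      using image_subset[OF xy(1)] agree_off_sym agree_off_trans by fast
    then show "cyl A i (meet A x (cyl A i y)) = meet A (cyl A i x) (cyl A i y)"
      using i xy by (subst eq_iff) simp_all
  qed
  show "ax4 n A" by (simp add: ax4_def eq_iff)
  show "ax5 n A"
    unfolding ax5_def
  proof (intro conjI allI impI)
    fix i j assume ij: "i < n" "j < n"
    then show "diag A i j = diag A j i" by (auto simp: eq_iff)
    fix k assume k: "k < n" "k \<noteq> i" "k \<noteq> j"
    then show "leq A (meet A (diag A i k) (diag A k j)) (diag A i j)" using ij by auto
    have "f j = f i \<longleftrightarrow> (\<exists>g\<in>{f \<in> V. f j = f i}. agree_off n k f g)" if "f \<in> V" for f
      using that ij k by (auto simp: agree_off_def)
    then show "diag A j i = cyl A k (diag A j i)"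
      using ij k by (subst eq_iff) auto
  qed
  show "ax6 n A"
    unfolding ax6_def
  proof (intro allI impI ballI)
    fix i j x assume ij: "i < n" "j < n" "i \<noteq> j" and x: "x \<in> carrier A"
    have "f \<in> h x" if "f \<in> V" "f i = f j" "g \<in> h x" "g i = g j" "agree_off n i f g" for f g
    proof -
      have "f k = g k" if "k < n" for k
        using that \<open>f i = f j\<close> \<open>g i = g j\<close> \<open>agree_off n i f g\<close> ij
        unfolding agree_off_def by metis
      moreover have "g \<in> V" using image_subset x that by blast
      ultimately have "f = g"
        using \<open>f \<in> V\<close> by (intro unit_eqI)
      then show ?thesis using that by simp
    qed
    then show "leq A (meet A (cyl A i (meet A x (diag A i j))) (diag A i j)) x"
      using ij x by auto
  qed
qed

lemma word_closed:
  "x \<in> carrier A \<Longrightarrow> \<forall>t\<in>{1..m}. p t < n \<and> q t < n \<and> r t < n \<Longrightarrow> word A p q r m x \<in> carrier A"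
  by (induction m) auto

lemma comp_repl_less:
  "l < n \<Longrightarrow> \<forall>t\<in>{1..m}. q t < n \<Longrightarrow> comp_repl p q m l < n"
  by (induction m) (auto simp: repl_def)

text \<open>From a point \<open>f\<close> of a word, a walk leads to a point \<open>g\<close> of \<open>x\<close>: it alternately replaces an entry by another one
and changes an entry freely. Followed back from place \<open>l\<close> of \<open>g\<close>, an entry that was never at a
freely changed place comes from the place of \<open>f\<close> given by the composed replacements.\<close>
lemma word_rep:
  assumes "x \<in> carrier A" "\<forall>t\<in>{1..m}. p t < n \<and> q t < n \<and> r t < n" "f \<in> h (word A p q r m x)"
  shows "\<exists>g\<in>h x. \<forall>l<n. (\<forall>t<m. r (Suc t) \<noteq> comp_repl p q t l) \<longrightarrow> g l = f (comp_repl p q m l)"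
  using assms
proof (induction m arbitrary: f)
  case (Suc m)
  let ?W = "word A p q r m x" and ?p = "p (Suc m)" and ?q = "q (Suc m)" and ?r = "r (Suc m)"
  have bd: "\<forall>t\<in>{1..m}. p t < n \<and> q t < n \<and> r t < n" "?p < n" "?q < n" "?r < n"
    using Suc.prems(2) by auto
  have W: "?W \<in> carrier A" using word_closed Suc.prems(1) bd(1) by blast
  have "\<exists>f'\<in>h ?W. \<forall>l<n. l \<noteq> ?r \<longrightarrow> f' l = f (repl ?p ?q l)"
  proof (cases "?p = ?q")
    case True
    then show ?thesis
      using Suc.prems(3) bd W by (auto simp: sub_def agree_off_def repl_def)
  next
    case False
    then obtain g f' where g: "g ?p = g ?q" "agree_off n ?p f g"
      and f': "f' \<in> h ?W" "agree_off n ?r g f'"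
      using Suc.prems(3) bd W by (auto simp: sub_def)
    have "f' l = f (repl ?p ?q l)" if "l < n" "l \<noteq> ?r" for l
      using g f' that bd False by (auto simp: agree_off_def repl_def)
    then show ?thesis using f' by blast
  qed
  then obtain f' where f': "f' \<in> h ?W" "\<And>l. l < n \<Longrightarrow> l \<noteq> ?r \<Longrightarrow> f' l = f (repl ?p ?q l)" by blast
  obtain g where g: "g \<in> h x"
    "\<forall>l<n. (\<forall>t<m. r (Suc t) \<noteq> comp_repl p q t l) \<longrightarrow> g l = f' (comp_repl p q m l)"
    using Suc.IH[OF Suc.prems(1) bd(1) f'(1)] by blast
  have "g l = f (comp_repl p q (Suc m) l)"
    if "l < n" "\<forall>t<Suc m. r (Suc t) \<noteq> comp_repl p q t l" for l
    using that g(2) f'(2)[of "comp_repl p q m l"] comp_repl_less[OF \<open>l < n\<close>, of m q p] bd(1)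
    by (auto simp: less_Suc_eq)
  then show ?case using g(1) by blast
qed auto

text \<open>The side condition says that no entry with index in \<open>K\<close> is at a place changed freely, so \<open>word_rep\<close>
applies to it, and the diagonals bring it back to where it was. The entries outside \<open>K\<close> and different
from \<open>i\<close> are never touched.\<close>
lemma axiom_7: "ax7 n A"
  unfolding ax7_def
proof (intro allI impI ballI)
  fix m p q r i K x
  assume "1 \<le> (m::nat)" "i < n" and bd: "\<forall>t\<in>{1..m}. p t < n \<and> q t < n \<and> r t < n"
    and K: "K = p ` {1..m} \<union> r ` {1..m} - {i}"
    and free: "\<forall>t<m. r (Suc t) \<notin> comp_repl p q t ` K" and x: "x \<in> carrier A"
  let ?D = "\<lambda>l. diag A l (comp_repl p q m l)"
  have K_sub: "finite K" "K \<subseteq> {..<n}" using K bd by auto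
  have D: "l \<in> K \<Longrightarrow> ?D l \<in> carrier A" for l
    using K_sub(2) bd by (auto intro!: closed(7) comp_repl_less)
  have W: "word A p q r m x \<in> carrier A" using word_closed x bd by blast
  have fixed: "comp_repl p q t l = l" if "t \<le> m" "l \<notin> K" "l \<noteq> i" for t l
    using that K by (induction t) (auto simp: repl_def)
  have "f \<in> h (cyl A i x)"
    if f: "f \<in> V" "f \<in> h (word A p q r m x)" "\<forall>l\<in>K. f \<in> h (?D l)" for f
  proof -
    obtain g where g: "g \<in> h x"
      "\<forall>l<n. (\<forall>t<m. r (Suc t) \<noteq> comp_repl p q t l) \<longrightarrow> g l = f (comp_repl p q m l)"
      using word_rep[OF x bd f(2)] by blast
    have "f l = g l" if l: "l < n" "l \<noteq> i" for l
    proof (cases "l \<in> K")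
      case True
      then have "\<forall>t<m. r (Suc t) \<noteq> comp_repl p q t l" using free by blast
      moreover have "f l = f (comp_repl p q m l)"
        using f(3) True l bd by (auto simp: comp_repl_less)
      ultimately show ?thesis using g(2) l by auto
    next
      case False
      have "r (Suc t) \<noteq> comp_repl p q t l" if "t < m" for t
      proof -
        have "comp_repl p q t l = l" using fixed that False l by simp
        moreover have "r (Suc t) \<in> K \<or> r (Suc t) = i" using that K by auto
        ultimately show ?thesis using False l by metis
      qed
      then show ?thesis using g(2) l fixed[of m l] False by auto
    qed
    then show ?thesis using g(1) f(1) x \<open>i < n\<close> by (auto simp: agree_off_def)
  qed
  then show "leq A (meet A (word A p q r m x) (big_meet A ?D K)) (cyl A i x)"
    using W x \<open>i < n\<close> big_meet_rep[OF K_sub(1) D] image_subset[OF W]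
    by (subst leq_iff) (auto simp del: hom(6))
qed

lemma RC: "A \<in> RC n"
  using alg axioms_0_to_6 axiom_7 by (simp add: RC_def)

end

locale diag_represented = represented +
  assumes diagonal: "diagonalizable n V"
begin

lemma repl_in: "f \<in> V \<Longrightarrow> i < n \<Longrightarrow> j < n \<Longrightarrow> f \<circ> repl i j \<in> V"
  using diagonal by (simp add: diagonalizable_def)

text \<open>A sequence of \<open>V\<close> with equal entries at \<open>i\<close> and \<open>j\<close> which agrees with \<open>f\<close> off \<open>i\<close> can only be
\<open>f \<circ> repl i j\<close>, and a diagonalizable \<open>V\<close> contains it. Therefore words of substitutions act by plain
composition, and (Ax10) reduces to comparing two maps off \<open>k\<close>.\<close>
lemma sub_rep [simp]:
  assumes "i < n" "j < n" "x \<in> carrier A"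
  shows "h (sub A i j x) = {f \<in> V. f \<circ> repl i j \<in> h x}"
proof (cases "i = j")
  case True
  then have "repl i j = id" by (auto simp: repl_def)
  then show ?thesis using True assms image_subset by (auto simp: sub_def)
next
  case False
  have "g = f \<circ> repl i j" if "f \<in> V" "g \<in> h x" "g i = g j" "agree_off n i f g" for f g
    using that assms False image_subset repl_in
    by (intro unit_eqI) (auto simp: agree_off_def repl_def)
  moreover have "\<exists>g\<in>h x. g i = g j \<and> agree_off n i f g" if "f \<circ> repl i j \<in> h x" for f
    using that False by (intro bexI[of _ "f \<circ> repl i j"]) (auto simp: agree_off_def repl_def)
  ultimately have "f \<in> V \<and> (\<exists>g\<in>h x. g i = g j \<and> agree_off n i f g) \<longleftrightarrow> f \<in> V \<and> f \<circ> repl i j \<in> h x" for f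
    by blast
  moreover have "f \<in> h (sub A i j x) \<longleftrightarrow> f \<in> V \<and> (\<exists>g\<in>h x. g i = g j \<and> agree_off n i f g)" for f
    using assms False image_subset by (auto simp: sub_def)
  ultimately show ?thesis by blast
qed

lemma cyl_cong:
  assumes "f \<in> V" "g \<in> V" "k < n" "agree_off n k f g" "x \<in> carrier A"
  shows "f \<in> h (cyl A k x) \<longleftrightarrow> g \<in> h (cyl A k x)"
  using assms by (auto simp: agree_off_def)

lemma axioms_8_to_10: "ax8 n A" "ax9 n A" "ax10 n A"
proof -
  show "ax8 n A"
    unfolding ax8_def
  proof (intro allI impI ballI)
    fix i j k x assume ijk: "i < n" "j < n" "k < n" "k \<noteq> i" "k \<noteq> j" and x: "x \<in> carrier A"
    \<comment> \<open>The intermediate sequence has the \<open>j\<close>-th entry of \<open>f\<close>, which is the \<open>k\<close>-th one of \<open>f\<close> and hence of \<open>u\<close>.\<close>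
    have "\<exists>g'\<in>V. agree_off n i f g' \<and> agree_off n j g' u"
      if f: "f \<in> V" "f j = f k" "agree_off n j f g" "agree_off n i g u" "u \<in> h x" for f g u
    proof (cases "i = j")
      case True
      then show ?thesis using f by (intro bexI[of _ f]) (auto simp: agree_off_def)
    next
      case False
      then show ?thesis
        using f ijk repl_in[of u j k] image_subset[OF x]
        by (intro bexI[of _ "u \<circ> repl j k"]) (auto simp: agree_off_def repl_def)
    qed
    then show "leq A (meet A (cyl A j (cyl A i x)) (diag A j k)) (cyl A i (cyl A j x))"
      using ijk x by (auto; blast)
  qed
  show "ax9 n A"
    unfolding ax9_def
  proof (intro allI impI)
    fix i j k assume ijk: "i < n" "j < n" "k < n" "k \<noteq> i" "k \<noteq> j"
    have "\<exists>g\<in>{f \<in> V. f i = f k} \<inter> {f \<in> V. f k = f j}. agree_off n k f g"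
      if "f \<in> V" "f i = f j" for f
      using that ijk repl_in[of f k i]
      by (intro bexI[of _ "f \<circ> repl k i"]) (auto simp: agree_off_def repl_def)
    moreover have "f i = f j" if "g i = g k" "g k = g j" "agree_off n k f g" for f g
      using that ijk by (auto simp: agree_off_def)
    ultimately show "diag A i j = cyl A k (meet A (diag A i k) (diag A k j))"
      using ijk by (subst eq_iff) auto
  qed
  show "ax10 n A"
    unfolding ax10_def
  proof (intro allI impI ballI)
    fix i j k m x
    assume ijkm: "i < n" "j < n" "k < n" "m < n" "k \<noteq> i" "k \<noteq> j" "k \<noteq> m" "m \<noteq> i" "m \<noteq> j"
      and x: "x \<in> carrier A"
    have "f \<circ> repl k i \<circ> repl i j \<circ> repl j m \<circ> repl m k \<in> h (cyl A k x) \<longleftrightarrow>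
        f \<circ> repl k m \<circ> repl m i \<circ> repl i j \<circ> repl j k \<in> h (cyl A k x)" if "f \<in> V" for f
      using that ijkm x
      by (intro cyl_cong repl_in) (auto simp: agree_off_def repl_def)
    then show "sub A k i (sub A i j (sub A j m (sub A m k (cyl A k x)))) =
       sub A k m (sub A m i (sub A i j (sub A j k (cyl A k x))))"
      using ijkm x by (subst eq_iff) (auto simp: repl_in simp del: hom(6))
  qed
qed

lemma DC: "A \<in> DC n"
  using RC axioms_8_to_10 by (simp add: DC_def)

end

locale perm_represented = diag_represented +
  assumes permutes: "permutable n V"
begin

lemma transpose_in: "f \<in> V \<Longrightarrow> i < n \<Longrightarrow> j < n \<Longrightarrow> f \<circ> transpose i j \<in> V"
  using permutes by (simp add: permutable_def)

text \<open>The witness for (Ax11) and (Ax12) at \<open>f\<close> is \<open>f \<circ> [i,j]\<close>, which is reached from \<open>f\<close> through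
\<open>f \<circ> [i/j]\<close>.\<close>
lemma in_cyl_cyl:
  assumes "f \<in> V" "i < n" "j < n" "x \<in> carrier A" "f \<circ> transpose i j \<in> h x"
  shows "f \<in> h (cyl A i (cyl A j x))"
proof -
  have "agree_off n i f (f \<circ> repl i j)" "agree_off n j (f \<circ> repl i j) (f \<circ> transpose i j)"
    by (auto simp: agree_off_def repl_def transpose_def)
  then show ?thesis using assms repl_in[of f i j] by auto
qed

lemma in_cyl:
  assumes "f \<in> h x" "g \<in> V" "agree_off n k g f" "x \<in> carrier A" "k < n"
  shows "g \<in> h (cyl A k x)"
  using assms by auto

lemma axiom_11: "n = 2 \<Longrightarrow> ax11 A"
  unfolding ax11_def
proof (intro ballI)
  fix x assume n: "n = 2" and x: "x \<in> carrier A"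
  let ?z = "meet A (meet A (compl A (diag A 0 1)) (sub A 0 1 (cyl A 1 x))) (sub A 1 0 (cyl A 0 x))"
  have z: "?z \<in> carrier A" using n x by simp
  have "f \<in> h (cyl A 0 (cyl A 1 ?z))" if f: "f \<in> h x" "f 0 \<noteq> f 1" for f
  proof -
    have fV: "f \<in> V" using f image_subset[OF x] by blast
    let ?g = "f \<circ> transpose 0 1"
    have g: "?g \<in> V" using transpose_in fV n by simp
    have "?g \<circ> repl 0 1 \<in> V" "?g \<circ> repl 1 0 \<in> V" using g n by (auto intro: repl_in)
    moreover have "agree_off n 1 (?g \<circ> repl 0 1) f" "agree_off n 0 (?g \<circ> repl 1 0) f"
      using n by (auto simp: agree_off_def repl_def less_2_cases_iff)
    ultimately have "?g \<circ> repl 0 1 \<in> h (cyl A 1 x)" "?g \<circ> repl 1 0 \<in> h (cyl A 0 x)"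
      using in_cyl[OF f(1)] n x by auto
    then have "?g \<in> h ?z"
      using n x g f by (auto simp: simp del: hom(6))
    then show ?thesis
      using in_cyl_cyl[OF fV _ _ z, of 0 1] n by simp
  qed
  then show "leq A (meet A x (compl A (diag A 0 1))) (cyl A 0 (cyl A 1 ?z))"
    using n x z by (subst leq_iff) (auto simp del: hom(6))
qed

lemma axiom_12: "ax12 n A"
  unfolding ax12_def
proof (intro allI impI ballI)
  fix i j x assume ij: "i < n" "j < n" and x: "x \<in> carrier A"
  let ?F = "\<lambda>k. sub A k i (sub A i j (sub A j k (cyl A k x)))"
  let ?z = "meet A (meet A (sub A i j (cyl A j x)) (sub A j i (cyl A i x)))
    (big_meet A ?F ({..<n} - {i, j}))"
  have B: "big_meet A ?F ({..<n} - {i, j}) \<in> carrier A"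
    "h (big_meet A ?F ({..<n} - {i, j})) = {f \<in> V. \<forall>k\<in>{..<n} - {i, j}. f \<in> h (?F k)}"
    by (rule big_meet_rep; use ij x in simp)+
  have z: "?z \<in> carrier A" using ij x B by simp
  have "f \<in> h (cyl A i (cyl A j ?z))" if f: "f \<in> h x" for f
  proof -
    have fV: "f \<in> V" using f image_subset[OF x] by blast
    let ?g = "f \<circ> transpose i j"
    have g: "?g \<in> V" using transpose_in fV ij by simp
    have "?g \<circ> repl i j \<in> V" "?g \<circ> repl j i \<in> V" using g ij by (auto intro: repl_in)
    moreover have "agree_off n j (?g \<circ> repl i j) f" "agree_off n i (?g \<circ> repl j i) f"
      by (auto simp: agree_off_def repl_def transpose_def)
    ultimately have "?g \<circ> repl i j \<in> h (cyl A j x)" "?g \<circ> repl j i \<in> h (cyl A i x)"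
      using in_cyl[OF f] ij x by auto
    moreover have "?g \<circ> repl k i \<circ> repl i j \<circ> repl j k \<in> h (cyl A k x)"
      if "k < n" "k \<noteq> i" "k \<noteq> j" for k
    proof (rule in_cyl[OF f])
      show "?g \<circ> repl k i \<circ> repl i j \<circ> repl j k \<in> V" using g ij that by (auto intro!: repl_in)
      show "agree_off n k (?g \<circ> repl k i \<circ> repl i j \<circ> repl j k) f"
        using that by (auto simp: agree_off_def repl_def transpose_def)
    qed (use x that in auto)
    ultimately have "?g \<in> h ?z"
      using ij x g f B by (auto simp: repl_in simp del: hom(6))
    then show ?thesis
      using in_cyl_cyl[OF fV _ _ z, of i j] ij by simp
  qed
  then show "leq A x (cyl A i (cyl A j ?z))"
    using ij x z by (subst leq_iff) (auto simp del: hom(6))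
qed

lemma SC: "A \<in> SC n"
  using DC axiom_11 axiom_12 by (simp add: SC_def)

end

section \<open>Ultrafilters\<close>
locale rc_algebra =
  fixes n :: nat and A :: "'a cyl_alg"
  assumes dim: "2 \<le> n" and RC: "A \<in> RC n"
begin

abbreviation C :: "'a set" where "C \<equiv> carrier A"
abbreviation meet_op (infixl "\<sqinter>" 70) where "x \<sqinter> y \<equiv> meet A x y"
abbreviation join_op (infixl "\<squnion>" 65) where "x \<squnion> y \<equiv> join A x y"
abbreviation le (infix "\<sqsubseteq>" 50) where "x \<sqsubseteq> y \<equiv> leq A x y"
abbreviation d :: "nat \<Rightarrow> nat \<Rightarrow> 'a" where "d \<equiv> diag A"

lemma alg: "algebra n A"
  using RC by (simp add: RC_def)

lemma ax: "ax0 A" "ax1 n A" "ax2 n A" "ax3 n A" "ax4 n A" "ax5 n A" "ax6 n A" "ax7 n A"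
  using RC by (simp_all add: RC_def)

lemma closed [simp]:
  "zero A \<in> C" "one A \<in> C"
  "x \<in> C \<Longrightarrow> y \<in> C \<Longrightarrow> x \<squnion> y \<in> C" "x \<in> C \<Longrightarrow> y \<in> C \<Longrightarrow> x \<sqinter> y \<in> C"
  "x \<in> C \<Longrightarrow> compl A x \<in> C" "i < n \<Longrightarrow> x \<in> C \<Longrightarrow> cyl A i x \<in> C"
  "i < n \<Longrightarrow> j < n \<Longrightarrow> d i j \<in> C"
  using alg by (auto simp: algebra_def)

lemma sub_closed [simp]: "i < n \<Longrightarrow> j < n \<Longrightarrow> x \<in> C \<Longrightarrow> sub A i j x \<in> C"
  by (simp add: sub_def)

lemma meet_assoc: "x \<in> C \<Longrightarrow> y \<in> C \<Longrightarrow> z \<in> C \<Longrightarrow> x \<sqinter> y \<sqinter> z = x \<sqinter> (y \<sqinter> z)"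
  and meet_join: "x \<in> C \<Longrightarrow> y \<in> C \<Longrightarrow> z \<in> C \<Longrightarrow> x \<sqinter> (y \<squnion> z) = x \<sqinter> y \<squnion> x \<sqinter> z"
  and join_commute: "x \<in> C \<Longrightarrow> y \<in> C \<Longrightarrow> x \<squnion> y = y \<squnion> x"
  and meet_commute: "x \<in> C \<Longrightarrow> y \<in> C \<Longrightarrow> x \<sqinter> y = y \<sqinter> x"
  and join_absorb: "x \<in> C \<Longrightarrow> y \<in> C \<Longrightarrow> x \<squnion> x \<sqinter> y = x"
  and meet_absorb: "x \<in> C \<Longrightarrow> y \<in> C \<Longrightarrow> x \<sqinter> (x \<squnion> y) = x"
  and join_zero: "x \<in> C \<Longrightarrow> x \<squnion> zero A = x"
  and meet_one: "x \<in> C \<Longrightarrow> x \<sqinter> one A = x"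
  and join_compl: "x \<in> C \<Longrightarrow> x \<squnion> compl A x = one A"
  and meet_compl: "x \<in> C \<Longrightarrow> x \<sqinter> compl A x = zero A"
  and zero_neq_one: "zero A \<noteq> one A"
  using ax(1) unfolding ax0_def by blast+

lemma meet_idem: "x \<in> C \<Longrightarrow> x \<sqinter> x = x"
  by (metis closed(4) join_absorb meet_absorb)

lemma meet_zero: "x \<in> C \<Longrightarrow> x \<sqinter> zero A = zero A"
  by (metis closed(5) meet_assoc meet_compl meet_idem)

lemma le_refl: "x \<in> C \<Longrightarrow> x \<sqsubseteq> x"
  by (simp add: leq_def meet_idem)

lemma le_trans: "x \<sqsubseteq> y \<Longrightarrow> y \<sqsubseteq> z \<Longrightarrow> x \<in> C \<Longrightarrow> y \<in> C \<Longrightarrow> z \<in> C \<Longrightarrow> x \<sqsubseteq> z"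
  unfolding leq_def by (metis meet_assoc)

lemma meet_le1: "x \<in> C \<Longrightarrow> y \<in> C \<Longrightarrow> x \<sqinter> y \<sqsubseteq> x"
  unfolding leq_def by (metis meet_assoc meet_commute meet_idem)

lemma meet_le2: "x \<in> C \<Longrightarrow> y \<in> C \<Longrightarrow> x \<sqinter> y \<sqsubseteq> y"
  by (metis meet_commute meet_le1)

lemma le_meet: "z \<sqsubseteq> x \<Longrightarrow> z \<sqsubseteq> y \<Longrightarrow> x \<in> C \<Longrightarrow> y \<in> C \<Longrightarrow> z \<in> C \<Longrightarrow> z \<sqsubseteq> x \<sqinter> y"
  unfolding leq_def by (metis meet_assoc)

lemma meet_mono:
  assumes "x \<sqsubseteq> x'" "y \<sqsubseteq> y'" "x \<in> C" "x' \<in> C" "y \<in> C" "y' \<in> C"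
  shows "x \<sqinter> y \<sqsubseteq> x' \<sqinter> y'"
  using assms meet_le1 meet_le2 le_trans le_meet by (meson closed(4))

lemma le_one: "x \<in> C \<Longrightarrow> x \<sqsubseteq> one A"
  by (simp add: leq_def meet_one)

lemma le_zero: "x \<in> C \<Longrightarrow> x \<sqsubseteq> zero A \<Longrightarrow> x = zero A"
  by (simp add: leq_def meet_zero)

lemma le_if_disjoint_compl:
  assumes "x \<in> C" "y \<in> C" "x \<sqinter> compl A y = zero A"
  shows "x \<sqsubseteq> y"
  unfolding leq_def using assms
  by (metis closed(4,5) join_compl join_zero meet_join meet_one)

lemma cyl_extensive: "i < n \<Longrightarrow> x \<in> C \<Longrightarrow> x \<sqsubseteq> cyl A i x"
  using ax(3) by (simp add: ax2_def)

lemma cyl_meet: "i < n \<Longrightarrow> x \<in> C \<Longrightarrow> y \<in> C \<Longrightarrow> cyl A i (x \<sqinter> cyl A i y) = cyl A i x \<sqinter> cyl A i y"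
  using ax(4) by (simp add: ax3_def)

lemma cyl_zero: "i < n \<Longrightarrow> cyl A i (zero A) = zero A"
  using ax(2) by (simp add: ax1_def)

lemma cyl_one: "i < n \<Longrightarrow> cyl A i (one A) = one A"
  using cyl_extensive[of i "one A"] unfolding leq_def by (metis closed(2,6) meet_commute meet_one)

lemma cyl_idem: "i < n \<Longrightarrow> x \<in> C \<Longrightarrow> cyl A i (cyl A i x) = cyl A i x"
  using cyl_meet[of i "one A" x] by (metis closed(2,6) cyl_one meet_commute meet_one)

lemma cyl_mono:
  assumes "i < n" "x \<in> C" "y \<in> C" "x \<sqsubseteq> y"
  shows "cyl A i x \<sqsubseteq> cyl A i y"
proof -
  have "x \<sqsubseteq> cyl A i y" using assms cyl_extensive le_trans closed(6) by metis
  then show ?thesis using assms cyl_meet unfolding leq_def by metis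
qed

lemma sub_mono:
  "i < n \<Longrightarrow> j < n \<Longrightarrow> x \<in> C \<Longrightarrow> y \<in> C \<Longrightarrow> x \<sqsubseteq> y \<Longrightarrow> sub A i j x \<sqsubseteq> sub A i j y"
  by (simp add: sub_def cyl_mono meet_mono le_refl)

definition ultra :: "'a set \<Rightarrow> bool" where
  "ultra U \<longleftrightarrow> U \<subseteq> C \<and> zero A \<notin> U \<and> one A \<in> U \<and> (\<forall>x\<in>U. \<forall>y\<in>U. x \<sqinter> y \<in> U) \<and>
     (\<forall>x\<in>U. \<forall>y\<in>C. x \<sqsubseteq> y \<longrightarrow> y \<in> U) \<and> (\<forall>x\<in>C. x \<in> U \<or> compl A x \<in> U)"

lemma ultra_carrier: "ultra U \<Longrightarrow> x \<in> U \<Longrightarrow> x \<in> C"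
  and ultra_zero: "ultra U \<Longrightarrow> zero A \<notin> U"
  and ultra_one: "ultra U \<Longrightarrow> one A \<in> U"
  and ultra_meetI: "ultra U \<Longrightarrow> x \<in> U \<Longrightarrow> y \<in> U \<Longrightarrow> x \<sqinter> y \<in> U"
  and ultra_up: "ultra U \<Longrightarrow> x \<in> U \<Longrightarrow> x \<sqsubseteq> y \<Longrightarrow> y \<in> C \<Longrightarrow> y \<in> U"
  and ultra_total: "ultra U \<Longrightarrow> x \<in> C \<Longrightarrow> x \<in> U \<or> compl A x \<in> U"
  by (auto simp: ultra_def)

lemma ultra_meet_iff: "ultra U \<Longrightarrow> x \<in> C \<Longrightarrow> y \<in> C \<Longrightarrow> x \<sqinter> y \<in> U \<longleftrightarrow> x \<in> U \<and> y \<in> U"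
  using meet_le1 meet_le2 ultra_meetI ultra_up by metis

lemma ultra_compl_iff: "ultra U \<Longrightarrow> x \<in> C \<Longrightarrow> compl A x \<in> U \<longleftrightarrow> x \<notin> U"
  by (metis meet_compl ultra_meetI ultra_total ultra_zero)

lemma ultra_join_iff:
  assumes U: "ultra U" and x: "x \<in> C" and y: "y \<in> C"
  shows "x \<squnion> y \<in> U \<longleftrightarrow> x \<in> U \<or> y \<in> U"
proof
  have up: "x \<squnion> y \<in> U" if "x \<in> U" "x \<in> C" "y \<in> C" for x y
    using ultra_up[OF U that(1), of "x \<squnion> y"] meet_absorb that by (simp add: leq_def)
  show "x \<squnion> y \<in> U" if "x \<in> U \<or> y \<in> U"
    using that up x y join_commute by metis
  show "x \<in> U \<or> y \<in> U" if "x \<squnion> y \<in> U"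
  proof (rule ccontr)
    let ?z = "compl A x \<sqinter> compl A y"
    assume "\<not> (x \<in> U \<or> y \<in> U)"
    then have "?z \<in> U" using U x y by (simp add: ultra_meet_iff ultra_compl_iff)
    then have "?z \<sqinter> (x \<squnion> y) \<in> U" using that U ultra_meetI by blast
    moreover have "?z \<sqinter> x = zero A" "?z \<sqinter> y = zero A"
      using x y meet_compl meet_zero by (metis closed(1,5) meet_assoc meet_commute)+
    then have "?z \<sqinter> (x \<squnion> y) = zero A" using x y by (simp add: meet_join join_zero)
    ultimately show False using U ultra_zero by metis
  qed
qed

lemma ultra_eqI: "ultra U \<Longrightarrow> ultra W \<Longrightarrow> U \<subseteq> W \<Longrightarrow> U = W"
  using ultra_carrier ultra_compl_iff by blast

text \<open>Zorn's lemma is applied to the meet-closed sets without zero that include \<open>D\<close>. In a maximal one, \<open>M\<close>, everything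
above a meet of \<open>x\<close> with an element of \<open>M\<close> belongs to \<open>M\<close>, as soon as all these meets are nonzero.\<close>
lemma ultra_extend:
  assumes D: "D \<subseteq> C" "D \<noteq> {}" "zero A \<notin> D" "\<And>x y. x \<in> D \<Longrightarrow> y \<in> D \<Longrightarrow> x \<sqinter> y \<in> D"
  shows "\<exists>U. ultra U \<and> D \<subseteq> U"
proof -
  let ?F = "{E. D \<subseteq> E \<and> E \<subseteq> C \<and> zero A \<notin> E \<and> (\<forall>x\<in>E. \<forall>y\<in>E. x \<sqinter> y \<in> E)}"
  have "\<exists>M\<in>?F. \<forall>X\<in>?F. M \<subseteq> X \<longrightarrow> X = M"
  proof (rule subset_Zorn_nonempty)
    have "D \<in> ?F" using D by simp
    then show "?F \<noteq> {}" by blast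
    fix K assume K: "K \<noteq> {}" "subset.chain ?F K"
    have "x \<sqinter> y \<in> \<Union>K" if xy: "x \<in> X" "X \<in> K" "y \<in> Y" "Y \<in> K" for x y X Y
    proof -
      have "X \<subseteq> Y \<or> Y \<subseteq> X" using K xy by (auto simp: subset.chain_def)
      then obtain Z where Z: "Z \<in> K" "x \<in> Z" "y \<in> Z" using xy by blast
      then have "Z \<in> ?F" using K(2) by (auto simp: subset.chain_def)
      then show ?thesis using Z by (intro UnionI[of Z]) auto
    qed
    moreover have "K \<subseteq> ?F" using K(2) by (simp add: subset.chain_def)
    then have "D \<subseteq> X \<and> X \<subseteq> C \<and> zero A \<notin> X" if "X \<in> K" for X using that by auto
    then have "D \<subseteq> \<Union>K" "\<Union>K \<subseteq> C" "zero A \<notin> \<Union>K" using K(1) by blast+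
    ultimately show "\<Union>K \<in> ?F" by auto
  qed
  then obtain M where "M \<in> ?F" and max: "\<forall>X\<in>?F. M \<subseteq> X \<longrightarrow> X = M" by (elim bexE)
  then have M: "D \<subseteq> M" "M \<subseteq> C" "zero A \<notin> M" "\<And>x y. x \<in> M \<Longrightarrow> y \<in> M \<Longrightarrow> x \<sqinter> y \<in> M"
    by simp_all
  have up: "z \<in> M" if x: "x \<in> C" and pos: "\<And>y. y \<in> M \<Longrightarrow> y \<sqinter> x \<noteq> zero A"
    and z: "z \<in> C" "y0 \<in> M" "y0 \<sqinter> x \<sqsubseteq> z" for x z y0
  proof -
    define E where "E = {z \<in> C. \<exists>y\<in>M. y \<sqinter> x \<sqsubseteq> z}"
    have E_iff: "v \<in> E \<longleftrightarrow> v \<in> C \<and> (\<exists>y\<in>M. y \<sqinter> x \<sqsubseteq> v)" for v by (simp add: E_def)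
    have MC: "y \<in> C" if "y \<in> M" for y using M(2) that by blast
    have sub: "M \<subseteq> E" using MC x meet_le1 E_iff by blast
    have E_meet: "v \<sqinter> v' \<in> E" if v: "v \<in> E" "v' \<in> E" for v v'
    proof -
      obtain y y' where y: "v \<in> C" "v' \<in> C" "y \<in> M" "y' \<in> M" "y \<sqinter> x \<sqsubseteq> v" "y' \<sqinter> x \<sqsubseteq> v'"
        using v E_iff by metis
      then have C: "y \<in> C" "y' \<in> C" using MC by auto
      have "(y \<sqinter> y') \<sqinter> x = (y \<sqinter> x) \<sqinter> (y' \<sqinter> x)"
        using C x by (metis closed(4) meet_assoc meet_commute meet_idem)
      also have "\<dots> \<sqsubseteq> v \<sqinter> v'" using y C x by (simp add: meet_mono)
      finally show ?thesis using E_iff y M(4) closed(4) by blast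
    qed
    have "zero A \<notin> E"
    proof
      assume "zero A \<in> E"
      then obtain y where y: "y \<in> M" "y \<sqinter> x \<sqsubseteq> zero A" using E_iff by blast
      then have "y \<sqinter> x = zero A" using le_zero MC x by simp
      then show False using pos y by blast
    qed
    moreover have "D \<subseteq> E" "E \<subseteq> C" using sub M(1) E_iff by blast+
    ultimately have "E \<in> ?F" using E_meet by simp
    then have "E = M" using max sub by blast
    then show ?thesis using E_iff z by blast
  qed
  have up1: "z \<in> M" if "x \<in> M" "z \<in> C" "x \<sqsubseteq> z" for x z
  proof -
    have "x \<in> C" using that M(2) by blast
    moreover have "y \<sqinter> x \<noteq> zero A" if "y \<in> M" for y using M(3) M(4)[OF that \<open>x \<in> M\<close>] by metis
    moreover have "x \<sqinter> x \<sqsubseteq> z" using that \<open>x \<in> C\<close> meet_idem by simp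
    ultimately show ?thesis using up that by blast
  qed
  obtain w where w: "w \<in> M" using D M(1) by blast
  have mem: "x \<in> M" if "x \<in> C" "\<And>y. y \<in> M \<Longrightarrow> y \<sqinter> x \<noteq> zero A" for x
  proof -
    have "w \<sqinter> x \<sqsubseteq> x" using that(1) w M(2) meet_le2 by blast
    then show ?thesis using up[OF that that(1) w] by blast
  qed
  have "x \<in> M \<or> compl A x \<in> M" if x: "x \<in> C" for x
  proof (rule ccontr)
    assume "\<not> ?thesis"
    then obtain y y' where y: "y \<in> M" "y \<sqinter> x = zero A" "y' \<in> M" "y' \<sqinter> compl A x = zero A"
      using mem[of x] mem[of "compl A x"] x by auto
    then have C: "y \<in> C" "y' \<in> C" using M(2) by auto
    have "y' \<sqsubseteq> x" using le_if_disjoint_compl C x y by blast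
    then have "y \<sqinter> y' \<sqsubseteq> y \<sqinter> x" using C x by (simp add: meet_mono le_refl)
    then show False using M(3,4) y C le_zero by (metis closed(4))
  qed
  moreover have "w \<in> C" using w M(2) by blast
  then have "one A \<in> M" by (rule up1[OF w closed(2) le_one])
  ultimately have "ultra M" unfolding ultra_def using M(2-4) up1 by simp
  then show ?thesis using M(1) by blast
qed

lemma ultra_separates:
  assumes x: "x \<in> C" and y: "y \<in> C" and "\<not> x \<sqsubseteq> y"
  shows "\<exists>U. ultra U \<and> x \<in> U \<and> y \<notin> U"
proof -
  have "x \<sqinter> compl A y \<noteq> zero A" using assms le_if_disjoint_compl by blast
  then obtain U where "ultra U" "x \<sqinter> compl A y \<in> U"
    using ultra_extend[of "{x \<sqinter> compl A y}"] x y meet_idem by auto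
  then show ?thesis using ultra_meet_iff ultra_compl_iff x y by auto
qed

text \<open>For the points \<open>a\<close> and \<open>b\<close> of the Stone space, this is the relation dual to \<open>c\<^sub>i\<close>. In a set algebra it
holds between the ultrafilters of two points that agree off \<open>i\<close>.\<close>
definition near :: "nat \<Rightarrow> 'a set \<Rightarrow> 'a set \<Rightarrow> bool" where
  "near i a b \<longleftrightarrow> (\<forall>x\<in>a. cyl A i x \<in> b)"

lemma near_refl: "ultra a \<Longrightarrow> i < n \<Longrightarrow> near i a a"
  unfolding near_def using cyl_extensive ultra_up ultra_carrier by (meson closed(6))

lemma near_sym:
  assumes "ultra a" "ultra b" "i < n" "near i a b"
  shows "near i b a"
  unfolding near_def
proof (rule ccontr)
  assume "\<not> (\<forall>x\<in>b. cyl A i x \<in> a)"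
  then obtain x where x: "x \<in> b" "cyl A i x \<notin> a" by blast
  let ?z = "compl A (cyl A i x)"
  have xC: "x \<in> C" using x assms ultra_carrier by blast
  then have "?z \<in> a" using x assms ultra_compl_iff by auto
  then have "cyl A i ?z \<in> b" using assms(4) by (simp add: near_def)
  moreover have "cyl A i x \<in> b"
    using near_refl x assms by (simp add: near_def)
  ultimately have "cyl A i ?z \<sqinter> cyl A i x \<in> b" using assms ultra_meetI by blast
  moreover have "?z \<sqinter> cyl A i x = zero A"
    using xC \<open>i < n\<close> meet_compl meet_commute by (metis closed(5,6))
  then have "cyl A i ?z \<sqinter> cyl A i x = zero A"
    using cyl_meet[of i ?z x] xC \<open>i < n\<close> cyl_zero by simp
  ultimately show False using assms ultra_zero by metis
qed

lemma near_cyl: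
  assumes "ultra a" "ultra b" "i < n" "near i a b" "x \<in> C" "cyl A i x \<in> a"
  shows "cyl A i x \<in> b"
  using assms cyl_idem unfolding near_def by metis

text \<open>The sets \<open>Z\<close> and \<open>{c\<^sub>i y | y \<in> b}\<close> generate a proper filter: a meet \<open>z \<cdot> c\<^sub>i y\<close> is nonzero because, by (Ax3),
applying \<open>c\<^sub>i\<close> to it gives \<open>c\<^sub>i z \<cdot> c\<^sub>i y \<in> b\<close>.\<close>
lemma near_extend:
  assumes b: "ultra b" and i: "i < n" and Z: "Z \<subseteq> C" "Z \<noteq> {}"
    and directed: "\<And>y z. y \<in> Z \<Longrightarrow> z \<in> Z \<Longrightarrow> \<exists>u\<in>Z. u \<sqsubseteq> y \<and> u \<sqsubseteq> z"
    and cyl_in: "\<And>z. z \<in> Z \<Longrightarrow> cyl A i z \<in> b"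
  shows "\<exists>e. ultra e \<and> Z \<subseteq> e \<and> near i e b"
proof -
  define D where "D = {u \<in> C. \<exists>z\<in>Z. \<exists>y\<in>b. z \<sqinter> cyl A i y \<sqsubseteq> u}"
  have D_iff: "u \<in> D \<longleftrightarrow> u \<in> C \<and> (\<exists>z\<in>Z. \<exists>y\<in>b. z \<sqinter> cyl A i y \<sqsubseteq> u)" for u
    by (simp add: D_def)
  have bC: "y \<in> C" if "y \<in> b" for y using b that ultra_carrier by blast
  obtain z0 where z0: "z0 \<in> Z" using Z by blast
  have D_meet: "u \<sqinter> u' \<in> D" if uu: "u \<in> D" "u' \<in> D" for u u'
  proof -
    obtain z y z' y' where zy: "z \<in> Z" "y \<in> b" "z \<sqinter> cyl A i y \<sqsubseteq> u" "u \<in> C"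
      and zy': "z' \<in> Z" "y' \<in> b" "z' \<sqinter> cyl A i y' \<sqsubseteq> u'" "u' \<in> C" using uu D_iff by metis
    obtain v where v: "v \<in> Z" "v \<sqsubseteq> z" "v \<sqsubseteq> z'" using directed zy zy' by blast
    have C: "v \<in> C" "z \<in> C" "z' \<in> C" "y \<in> C" "y' \<in> C" using zy zy' v Z bC by auto
    let ?w = "v \<sqinter> cyl A i (y \<sqinter> y')"
    have "?w \<sqsubseteq> z \<sqinter> cyl A i y" "?w \<sqsubseteq> z' \<sqinter> cyl A i y'"
      using v C i by (auto intro!: meet_mono cyl_mono meet_le1 meet_le2)
    then have "?w \<sqsubseteq> u \<sqinter> u'"
      using zy zy' C i by (auto intro!: le_meet intro: le_trans)
    moreover have "y \<sqinter> y' \<in> b" using b zy zy' ultra_meetI by blast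
    ultimately show ?thesis using v zy zy' D_iff by auto
  qed
  have D_zero: "zero A \<notin> D"
  proof
    assume "zero A \<in> D"
    then obtain z y where zy: "z \<in> Z" "y \<in> b" "z \<sqinter> cyl A i y \<sqsubseteq> zero A" using D_iff by blast
    then have C: "z \<in> C" "y \<in> C" using Z bC by auto
    then have "z \<sqinter> cyl A i y = zero A" using le_zero zy i by simp
    then have "cyl A i z \<sqinter> cyl A i y = zero A" using cyl_meet cyl_zero i C by metis
    moreover have "cyl A i y \<in> b" using near_refl b i zy(2) by (simp add: near_def)
    ultimately show False using cyl_in zy(1) b ultra_meetI ultra_zero by metis
  qed
  have in_D: "z \<in> D" "cyl A i y \<in> D" if "z \<in> Z" "y \<in> b" for z y
  proof -
    have "z \<in> C" "cyl A i y \<in> C" using that Z(1) bC i by auto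
    then have "z \<sqinter> cyl A i y \<sqsubseteq> z" "z \<sqinter> cyl A i y \<sqsubseteq> cyl A i y" using meet_le1 meet_le2 by blast+
    then show "z \<in> D" "cyl A i y \<in> D" using that \<open>z \<in> C\<close> \<open>cyl A i y \<in> C\<close> D_iff by blast+
  qed
  have "z0 \<in> D" using in_D(1)[OF z0 ultra_one[OF b]] .
  then have "D \<noteq> {}" "D \<subseteq> C" using D_iff by auto
  then obtain e where e: "ultra e" "D \<subseteq> e" using ultra_extend[OF _ _ D_zero D_meet] by blast
  have "near i b e" unfolding near_def using in_D(2)[OF z0] e(2) by (meson subsetD)
  moreover have "Z \<subseteq> e" using in_D(1)[OF _ ultra_one[OF b]] e(2) by (meson subsetD subsetI)
  ultimately show ?thesis using near_sym b e i by blast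
qed

lemma near_witness:
  assumes "ultra b" "i < n" "x \<in> C" "cyl A i x \<in> b"
  shows "\<exists>e. ultra e \<and> x \<in> e \<and> near i e b"
proof -
  have "\<exists>e. ultra e \<and> {x} \<subseteq> e \<and> near i e b"
    by (rule near_extend) (use assms le_refl in auto)
  then show ?thesis by blast
qed

lemma diag_refl: "ultra U \<Longrightarrow> i < n \<Longrightarrow> d i i \<in> U"
  using ax(5) ultra_one by (simp add: ax4_def)

lemma diag_commute: "i < n \<Longrightarrow> j < n \<Longrightarrow> d i j = d j i"
  using ax(6) unfolding ax5_def by blast

lemma diag_trans:
  assumes U: "ultra U" and "i < n" "j < n" "k < n" "d i k \<in> U" "d k j \<in> U"
  shows "d i j \<in> U"
proof (cases "k = i \<or> k = j")
  case False
  then have "d i k \<sqinter> d k j \<sqsubseteq> d i j" using ax(6) assms(2-4) unfolding ax5_def by blast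
  then show ?thesis using assms ultra_meetI[OF U] ultra_up[OF U] by (metis closed(7))
qed (use assms in auto)

lemma near_diag:
  assumes "ultra a" "ultra b" "k < n" "near k a b" "i < n" "j < n" "k \<noteq> i" "k \<noteq> j"
  shows "d i j \<in> a \<longleftrightarrow> d i j \<in> b"
proof -
  have "cyl A k (d i j) = d i j" using ax(6) assms unfolding ax5_def by metis
  then show ?thesis using near_cyl near_sym assms by (metis closed(7))
qed

text \<open>This is (Ax6): an entry that is bound by a diagonal to another one cannot vary.\<close>
lemma near_diag_eq:
  assumes "ultra a" "ultra b" "i < n" "j < n" "i \<noteq> j" "near i a b" "d i j \<in> a" "d i j \<in> b"
  shows "a = b"
proof (rule ultra_eqI[OF assms(1,2)])
  show "a \<subseteq> b"
  proof
    fix x assume "x \<in> a"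
    then have x: "x \<in> C" "x \<sqinter> d i j \<in> a" using assms ultra_carrier ultra_meetI by blast+
    then have "cyl A i (x \<sqinter> d i j) \<sqinter> d i j \<in> b"
      using assms ultra_meetI by (simp add: near_def)
    moreover have "cyl A i (x \<sqinter> d i j) \<sqinter> d i j \<sqsubseteq> x" using ax(7) assms x by (simp add: ax6_def)
    ultimately show "x \<in> b" using ultra_up assms(2) x by blast
  qed
qed

lemma big_meet_in:
  assumes U: "ultra U" and K: "finite K" "\<And>l. l \<in> K \<Longrightarrow> F l \<in> C"
  shows "big_meet A F K \<in> C" "big_meet A F K \<in> U \<longleftrightarrow> (\<forall>l\<in>K. F l \<in> U)"
proof -
  have "foldr (\<lambda>l y. F l \<sqinter> y) ls (one A) \<in> C \<and>
      (foldr (\<lambda>l y. F l \<sqinter> y) ls (one A) \<in> U \<longleftrightarrow> (\<forall>l\<in>set ls. F l \<in> U))"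
    if "\<And>l. l \<in> set ls \<Longrightarrow> F l \<in> C" for ls
    using that U by (induction ls) (auto simp: ultra_one ultra_meet_iff)
  from this[of "sorted_list_of_set K"] K
  show "big_meet A F K \<in> C" "big_meet A F K \<in> U \<longleftrightarrow> (\<forall>l\<in>K. F l \<in> U)"
    by (simp_all add: big_meet_def)
qed

section \<open>Walks through ultrafilters that keep all entries but one\<close>
text \<open>\<open>track i0 a0 \<tau> a\<close> describes a walk from \<open>a0\<close> to \<open>a\<close> together with the place \<open>\<tau> l\<close> at which the original
entry number \<open>l \<noteq> i0\<close> stands now. At a place not occupied by any of these entries, the walk may
proceed to any near ultrafilter. An entry at an occupied place \<open>r\<close> may be given up if a diagonal guarantees a copy
of it at another place \<open>j\<close>, to which the record is then moved. These are the words of (Ax7).\<close>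
inductive track :: "nat \<Rightarrow> 'a set \<Rightarrow> (nat \<Rightarrow> nat) \<Rightarrow> 'a set \<Rightarrow> bool" for i0 a0 where
  start: "track i0 a0 id a0"
| move: "track i0 a0 \<tau> a \<Longrightarrow> k < n \<Longrightarrow> k \<notin> \<tau> ` ({..<n} - {i0}) \<Longrightarrow> ultra b \<Longrightarrow> near k a b \<Longrightarrow>
    track i0 a0 \<tau> b"
| copy: "track i0 a0 \<tau> a \<Longrightarrow> r < n \<Longrightarrow> j < n \<Longrightarrow> r \<noteq> j \<Longrightarrow> d r j \<in> a \<Longrightarrow> ultra b \<Longrightarrow> near r a b \<Longrightarrow>
    track i0 a0 (repl r j \<circ> \<tau>) b"

lemma track_less: "track i0 a0 \<tau> a \<Longrightarrow> l < n \<Longrightarrow> \<tau> l < n"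
  by (induction rule: track.induct) (auto simp: repl_def)

lemma track_ultra: "track i0 a0 \<tau> a \<Longrightarrow> ultra a0 \<Longrightarrow> ultra a"
  by (induction rule: track.induct) auto

text \<open>Only \<open>n - 1\<close> entries are tracked, so one of the \<open>n\<close> places is free. The words of (Ax7) have a cylindrification
before each substitution, and a free place allows inserting one that does no harm.\<close>
lemma free_place:
  assumes "i0 < n"
  shows "\<exists>k<n. k \<notin> \<tau> ` ({..<n} - {i0})"
proof (rule ccontr)
  assume "\<not> ?thesis"
  then have "{..<n} \<subseteq> \<tau> ` ({..<n} - {i0})" by auto
  then have "n \<le> card ({..<n} - {i0})"
    by (metis card_lessThan card_mono finite_Diff finite_imageI finite_lessThan surj_card_le)
  then show False using assms by simp
qed

lemma word_cong:
  "(\<And>t. 1 \<le> t \<Longrightarrow> t \<le> m \<Longrightarrow> p t = p' t \<and> q t = q' t \<and> r t = r' t) \<Longrightarrow>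
    word B p q r m x = word B p' q' r' m x"
  by (induction m) auto

lemma comp_repl_cong:
  "(\<And>t. 1 \<le> t \<Longrightarrow> t \<le> m \<Longrightarrow> p t = p' t \<and> q t = q' t) \<Longrightarrow> comp_repl p q m = comp_repl p' q' m"
  by (induction m) auto

text \<open>The walk \<open>\<tau>\<close> from \<open>a0\<close> to \<open>b\<close> is spelled by a word with the side condition of (Ax7), where \<open>K\<close> is taken
to be all indices but \<open>i0\<close>. The larger set makes the condition independent of the word; an index that
does not occur in the word never moves, so nothing is lost.\<close>
definition reads :: "nat \<Rightarrow> 'a set \<Rightarrow> (nat \<Rightarrow> nat) \<Rightarrow> 'a set \<Rightarrow> bool" where
  "reads i0 a0 \<tau> b \<longleftrightarrow> (\<exists>m p q r. (\<forall>t\<in>{1..m}. p t < n \<and> q t < n \<and> r t < n) \<and>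
     \<tau> = comp_repl p q m \<and> (\<forall>t<m. r (Suc t) \<notin> comp_repl p q t ` ({..<n} - {i0})) \<and>
     (\<forall>x\<in>a0. word A p q r m x \<in> b))"

lemma reads_step:
  assumes "reads i0 a0 \<tau> a" and k: "k < n" "k \<notin> \<tau> ` ({..<n} - {i0})"
    and rj: "r0 < n" "j0 < n"
    and step: "\<And>y. y \<in> a \<Longrightarrow> sub A r0 j0 (cyl A k y) \<in> b"
  shows "reads i0 a0 (repl r0 j0 \<circ> \<tau>) b"
proof -
  obtain m p q r where bd: "\<forall>t\<in>{1..m}. p t < n \<and> q t < n \<and> r t < n"
    and \<tau>: "\<tau> = comp_repl p q m" and free: "\<forall>t<m. r (Suc t) \<notin> comp_repl p q t ` ({..<n} - {i0})"
    and W: "\<forall>x\<in>a0. word A p q r m x \<in> a"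
    using assms(1) unfolding reads_def by blast
  let ?p = "p(Suc m := r0)" and ?q = "q(Suc m := j0)" and ?r = "r(Suc m := k)"
  have comp: "comp_repl ?p ?q t = comp_repl p q t" if "t \<le> m" for t
    using that by (intro comp_repl_cong) auto
  have "\<forall>x. word A ?p ?q ?r m x = word A p q r m x" by (intro allI word_cong) auto
  then have "\<forall>x\<in>a0. word A ?p ?q ?r (Suc m) x \<in> b" using W step by auto
  moreover have "\<forall>t\<in>{1..Suc m}. ?p t < n \<and> ?q t < n \<and> ?r t < n" using bd k rj by auto
  moreover have "\<forall>t<Suc m. ?r (Suc t) \<notin> comp_repl ?p ?q t ` ({..<n} - {i0})"
    using free k \<tau> comp by (simp add: less_Suc_eq)
  moreover have "repl r0 j0 \<circ> \<tau> = comp_repl ?p ?q (Suc m)" using comp \<tau> by simp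
  ultimately show ?thesis unfolding reads_def by blast
qed

lemma track_reads:
  assumes "track i0 a0 \<tau> b" "ultra a0" "i0 < n"
  shows "reads i0 a0 \<tau> b"
  using assms
proof (induction rule: track.induct)
  case start
  show ?case unfolding reads_def by (intro exI[of _ 0]) auto
next
  case (move \<tau> a k b)
  have "sub A k k (cyl A k y) \<in> b" if "y \<in> a" for y
    using that move by (simp add: sub_def near_def)
  then have "reads i0 a0 (repl k k \<circ> \<tau>) b" using reads_step move by blast
  moreover have "repl k k = id" by (auto simp: repl_def)
  ultimately show ?case by simp
next
  case (copy \<tau> a r j b)
  have a: "ultra a" using track_ultra copy by blast
  obtain k where k: "k < n" "k \<notin> \<tau> ` ({..<n} - {i0})" using free_place copy.prems by blast
  have "sub A r j (cyl A k y) \<in> b" if "y \<in> a" for y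
  proof -
    have "cyl A k y \<in> a" using near_refl a k that by (simp add: near_def)
    then have "cyl A k y \<sqinter> d r j \<in> a" using copy a ultra_meetI by blast
    then show ?thesis using copy by (simp add: sub_def near_def)
  qed
  then show ?case using reads_step copy k by blast
qed

text \<open>If every tracked entry is back, up to equality, at its original place, then (Ax7) applies to the word that spells
the walk.\<close>
lemma track_near:
  assumes track: "track i0 a0 \<tau> b" and a0: "ultra a0" and i0: "i0 < n"
    and diag: "\<And>l. l < n \<Longrightarrow> l \<noteq> i0 \<Longrightarrow> d l (\<tau> l) \<in> b"
  shows "near i0 a0 b"
proof -
  have b: "ultra b" using track_ultra track a0 by blast
  obtain m p q r where bd: "\<forall>t\<in>{1..m}. p t < n \<and> q t < n \<and> r t < n"
    and \<tau>: "\<tau> = comp_repl p q m" and free: "\<forall>t<m. r (Suc t) \<notin> comp_repl p q t ` ({..<n} - {i0})"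
    and W: "\<forall>x\<in>a0. word A p q r m x \<in> b"
    using track_reads[OF track a0 i0] unfolding reads_def by blast
  show ?thesis
  proof (cases "m = 0")
    case True
    then have "a0 \<subseteq> b" using W by auto
    then have "a0 = b" using ultra_eqI a0 b by blast
    then show ?thesis using near_refl a0 i0 by blast
  next
    case False
    let ?K = "p ` {1..m} \<union> r ` {1..m} - {i0}"
    have K: "?K \<subseteq> {..<n} - {i0}" "finite ?K" using bd by auto
    have D: "d l (comp_repl p q m l) \<in> C" if "l \<in> ?K" for l
      using that K track_less[OF track] \<tau> by auto
    have "cyl A i0 x \<in> b" if x: "x \<in> a0" for x
    proof -
      have xC: "x \<in> C" using x a0 ultra_carrier by blast
      let ?M = "big_meet A (\<lambda>l. d l (comp_repl p q m l)) ?K"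
      have "\<forall>l\<in>?K. d l (comp_repl p q m l) \<in> b" using K(1) diag \<tau> by auto
      then have "?M \<in> b" using big_meet_in(2)[OF b K(2)] D by simp
      then have "word A p q r m x \<sqinter> ?M \<in> b" using W x b ultra_meetI by blast
      moreover have "\<forall>t<m. r (Suc t) \<notin> comp_repl p q t ` ?K" using free K(1) by blast
      then have "word A p q r m x \<sqinter> ?M \<sqsubseteq> cyl A i0 x"
        using ax(8)[unfolded ax7_def, rule_format, of m i0 p q r ?K x] bd i0 xC False by auto
      ultimately show ?thesis using ultra_up b xC i0 by auto
    qed
    then show ?thesis by (simp add: near_def)
  qed
qed

definition fits :: "(nat \<Rightarrow> 'b) \<Rightarrow> 'a set \<Rightarrow> bool" where
  "fits f a \<longleftrightarrow> (\<forall>k<n. \<forall>l<n. f k = f l \<longleftrightarrow> d k l \<in> a)"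

text \<open>The abstract walk of \<open>track\<close>, realised by sequences: all entries of \<open>f0\<close> except number \<open>i0\<close> are still
present in \<open>f\<close>, at the recorded places.\<close>
definition flow :: "nat \<Rightarrow> (nat \<Rightarrow> 'b) \<Rightarrow> 'a set \<Rightarrow> (nat \<Rightarrow> 'b) \<Rightarrow> 'a set \<Rightarrow> bool" where
  "flow i0 f0 a0 f a \<longleftrightarrow> (\<exists>\<tau>. track i0 a0 \<tau> a \<and> (\<forall>l<n. l \<noteq> i0 \<longrightarrow> f (\<tau> l) = f0 l))"

lemma flow_refl: "flow i0 f a f a"
  unfolding flow_def using track.start by fastforce

lemma flow_near:
  assumes "flow i0 f0 a0 f a" "fits f a" "ultra a0" "i0 < n" "agree_off n i0 f0 f"
  shows "near i0 a0 a"
proof -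
  obtain \<tau> where \<tau>: "track i0 a0 \<tau> a" "\<And>l. l < n \<Longrightarrow> l \<noteq> i0 \<Longrightarrow> f (\<tau> l) = f0 l"
    using assms(1) by (auto simp: flow_def)
  have "d l (\<tau> l) \<in> a" if "l < n" "l \<noteq> i0" for l
    using that \<tau> track_less assms(2,5) unfolding fits_def agree_off_def by metis
  then show ?thesis using track_near \<tau>(1) assms by blast
qed

text \<open>Changing the entry at \<open>r\<close> without losing a tracked value is always a legal move: if the old value is tracked, then
it still occurs in \<open>g\<close>, but not at \<open>r\<close>; so it also stood elsewhere in \<open>f\<close>, and the label of \<open>f\<close> contains
the diagonal needed for a copy. The value at \<open>r\<close> must really change: otherwise the label could change
while the tracked entry at \<open>r\<close> stays, which is not a legal move.\<close>
lemma flow_step: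
  assumes flow: "flow i0 f0 a0 f a" and fit: "fits f a" and b: "ultra b" and r: "r < n"
    and near: "near r a b" and fg: "agree_off n r f g" and neq: "g r \<noteq> f r"
    and keep: "f0 ` ({..<n} - {i0}) \<subseteq> g ` {..<n}"
  shows "flow i0 f0 a0 g b"
proof -
  obtain \<tau> where track: "track i0 a0 \<tau> a" and \<tau>: "\<And>l. l < n \<Longrightarrow> l \<noteq> i0 \<Longrightarrow> f (\<tau> l) = f0 l"
    using flow by (auto simp: flow_def)
  have off: "g (\<tau> l) = f (\<tau> l)" if "l < n" "\<tau> l \<noteq> r" for l
    using that fg track_less[OF track] by (simp add: agree_off_def)
  show ?thesis
  proof (cases "r \<in> \<tau> ` ({..<n} - {i0})")
    case False
    then have "track i0 a0 \<tau> b" using track.move track r b near by blast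
    moreover have "g (\<tau> l) = f0 l" if "l < n" "l \<noteq> i0" for l
    proof -
      have "\<tau> l \<noteq> r" using False that by auto
      then show ?thesis using off \<tau> that by simp
    qed
    ultimately show ?thesis unfolding flow_def by blast
  next
    case True
    then obtain l0 where "l0 < n" "l0 \<noteq> i0" "r = \<tau> l0" by auto
    then have "f r \<in> g ` {..<n}" using keep \<tau> by auto
    then obtain j where j: "j < n" "g j = f r" by auto
    then have "j \<noteq> r" using neq by auto
    then have "f j = f r" using j fg by (simp add: agree_off_def)
    then have "d r j \<in> a" using fit r j unfolding fits_def by metis
    then have "track i0 a0 (repl r j \<circ> \<tau>) b"
      using track.copy track r j \<open>j \<noteq> r\<close> b near by metis
    moreover have "\<forall>l<n. l \<noteq> i0 \<longrightarrow> g ((repl r j \<circ> \<tau>) l) = f0 l"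
      using off \<tau> j by (auto simp: repl_def)
    ultimately show ?thesis unfolding flow_def by blast
  qed
qed

section \<open>Exchanging two entries\<close>
text \<open>\<open>b\<close> can label \<open>f \<circ> [i,j]\<close> if \<open>a\<close> labels \<open>f\<close>. If the two entries are equal, nothing is to be done. Otherwise
they are exchanged by moves of \<open>track\<close>, which requires a free place; there is one chain of near
ultrafilters for each place that may be free. If that is \<open>j\<close> or \<open>i\<close>, it suffices to copy the other of the two entries
there. Any other free place \<open>k\<close> serves as a buffer: \<open>j\<close> is copied to \<open>k\<close>, then \<open>i\<close> to \<open>j\<close>, then \<open>k\<close> to
\<open>i\<close>.\<close>
definition swap :: "nat \<Rightarrow> nat \<Rightarrow> 'a set \<Rightarrow> 'a set \<Rightarrow> bool" where
  "swap i j a b \<longleftrightarrow> ultra a \<and> ultra b \<and> i < n \<and> j < n \<and> i \<noteq> j \<and>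
    (d i j \<in> a \<and> a = b \<or>
     d i j \<notin> a \<and> d i j \<notin> b \<and>
     (\<exists>e. ultra e \<and> d i j \<in> e \<and> near j a e \<and> near i e b) \<and>
     (\<exists>e. ultra e \<and> d i j \<in> e \<and> near i a e \<and> near j e b) \<and>
     (\<forall>k<n. k \<noteq> i \<longrightarrow> k \<noteq> j \<longrightarrow> (\<exists>e1 e2 e3. ultra e1 \<and> ultra e2 \<and> ultra e3 \<and>
        d j k \<in> e1 \<and> d i j \<in> e2 \<and> d k i \<in> e3 \<and>
        near k a e1 \<and> near j e1 e2 \<and> near i e2 e3 \<and> near k e3 b)))"

lemma swap_sym:
  assumes "swap i j a b"
  shows "swap j i b a"
proof -
  have sym: "near k y x" if "near k x y" "ultra x" "ultra y" "k < n" for k x y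
    using that near_sym by blast
  have d: "d j i = d i j" using assms diag_commute by (auto simp: swap_def)
  have ultra: "ultra a" "ultra b" "i < n" "j < n" using assms by (simp_all add: swap_def)
  have "\<exists>e1 e2 e3. ultra e1 \<and> ultra e2 \<and> ultra e3 \<and>
        d i k \<in> e1 \<and> d j i \<in> e2 \<and> d k j \<in> e3 \<and>
        near k b e1 \<and> near i e1 e2 \<and> near j e2 e3 \<and> near k e3 a"
    if nd: "d i j \<notin> a" and k: "k < n" "k \<noteq> i" "k \<noteq> j" for k
  proof -
    obtain e1 e2 e3 where e: "ultra e1" "ultra e2" "ultra e3" "d j k \<in> e1" "d i j \<in> e2" "d k i \<in> e3"
        "near k a e1" "near j e1 e2" "near i e2 e3" "near k e3 b"
      using assms nd k unfolding swap_def by metis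
    then have "d i k \<in> e3" "d j i \<in> e2" "d k j \<in> e1"
      using diag_commute[of i k] diag_commute[of j k] ultra k d by simp_all
    moreover have "near k b e3" "near i e3 e2" "near j e2 e1" "near k e1 a"
      using e ultra k sym by blast+
    ultimately show ?thesis using e by blast
  qed
  note chain = this
  show ?thesis
  proof (cases "d i j \<in> a")
    case True
    then show ?thesis using assms by (auto simp: swap_def d)
  next
    case False
    then obtain e e' where e: "ultra e" "d i j \<in> e" "near j a e" "near i e b"
      and e': "ultra e'" "d i j \<in> e'" "near i a e'" "near j e' b"
      using assms unfolding swap_def by metis
    then have "near i b e" "near j e a" "near j b e'" "near i e' a" using sym ultra by blast+
    moreover have "i \<noteq> j" "d i j \<notin> b" using False assms by (auto simp: swap_def)
    ultimately show ?thesis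
      unfolding swap_def d using ultra e(1,2) e'(1,2) False chain[OF False, unfolded d] by blast
  qed
qed

text \<open>Whether \<open>f k\<close> equals \<open>f i\<close>, for a third index \<open>k\<close>, is transported along the chain on which entry \<open>i\<close> is copied
to place \<open>j\<close>, and symmetrically for \<open>f j\<close>.\<close>
lemma swap_fits:
  assumes fit: "fits f a" and swap: "swap i j a b"
  shows "fits (f \<circ> transpose i j) b"
proof (cases "d i j \<in> a")
  case True
  then have "a = b" "f i = f j" using swap fit by (auto simp: swap_def fits_def)
  then have "f \<circ> transpose i j = f" by (auto simp: transpose_def)
  then show ?thesis using \<open>a = b\<close> fit by simp
next
  case False
  then obtain e e' where ij: "i < n" "j < n" "i \<noteq> j" and u: "ultra a" "ultra b"
    and dij: "d i j \<notin> a" "d i j \<notin> b"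
    and e: "ultra e" "d i j \<in> e" "near j a e" "near i e b"
    and e': "ultra e'" "d i j \<in> e'" "near i a e'" "near j e' b"
    using swap unfolding swap_def by metis
  have off: "d k l \<in> b \<longleftrightarrow> f k = f l" if "k < n" "l < n" "k \<noteq> i" "k \<noteq> j" "l \<noteq> i" "l \<noteq> j" for k l
    using that e u ij near_diag fit unfolding fits_def by metis
  have at_i: "d j k \<in> b \<longleftrightarrow> f i = f k" if k: "k < n" "k \<noteq> i" "k \<noteq> j" for k
  proof -
    have "f i = f k \<longleftrightarrow> d i k \<in> e" using fit ij k e(3) near_diag[OF u(1) e(1)] unfolding fits_def by metis
    also have "\<dots> \<longleftrightarrow> d j k \<in> e" using diag_trans[OF e(1)] diag_commute e(2) ij k by metis
    also have "\<dots> \<longleftrightarrow> d j k \<in> b" using ij k e(4) near_diag[OF e(1) u(2)] by metis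
    finally show ?thesis by blast
  qed
  have at_j: "d i k \<in> b \<longleftrightarrow> f j = f k" if k: "k < n" "k \<noteq> i" "k \<noteq> j" for k
  proof -
    have "f j = f k \<longleftrightarrow> d j k \<in> e'" using fit ij k e'(3) near_diag[OF u(1) e'(1)] unfolding fits_def by metis
    also have "\<dots> \<longleftrightarrow> d i k \<in> e'" using diag_trans[OF e'(1)] diag_commute e'(2) ij k by metis
    also have "\<dots> \<longleftrightarrow> d i k \<in> b" using ij k e'(4) near_diag[OF e'(1) u(2)] by metis
    finally show ?thesis by blast
  qed
  have "f i \<noteq> f j" using dij fit ij by (simp add: fits_def)
  then have "(f (transpose i j k) = f (transpose i j l)) = (d k l \<in> b)" if "k < n" "l < n" for k l
    using that ij dij diag_refl[OF u(2)] off[of k l] at_i[of k] at_i[of l] at_j[of k] at_j[of l]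
      diag_commute[of k l] diag_commute[of i j]
    unfolding transpose_def by auto
  then show ?thesis by (simp add: fits_def)
qed

lemma flow_swap:
  assumes flow: "flow i0 f0 a0 f a" and fit: "fits f a" and swap: "swap i j a b" and i0: "i0 < n"
  shows "flow i0 f0 a0 (f \<circ> transpose i j) b"
proof (cases "d i j \<in> a")
  case True
  then have "a = b" "f i = f j" using swap fit by (auto simp: swap_def fits_def)
  then have "f \<circ> transpose i j = f" by (auto simp: transpose_def)
  then show ?thesis using \<open>a = b\<close> flow by simp
next
  case False
  obtain \<tau> where track: "track i0 a0 \<tau> a" and \<tau>: "\<And>l. l < n \<Longrightarrow> l \<noteq> i0 \<Longrightarrow> f (\<tau> l) = f0 l"
    using flow by (auto simp: flow_def)
  have ij: "i < n" "j < n" "i \<noteq> j" "ultra b" using swap by (auto simp: swap_def)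
  obtain k where k: "k < n" "k \<notin> \<tau> ` ({..<n} - {i0})" using free_place i0 by blast
  consider "k = j" | "k = i" | "k \<noteq> i" "k \<noteq> j" by blast
  then show ?thesis
  proof cases
    case 1
    obtain e where e: "ultra e" "d i j \<in> e" "near j a e" "near i e b"
      using swap False unfolding swap_def by metis
    have "track i0 a0 (repl i j \<circ> \<tau>) b"
      using track.copy[OF track.move[OF track k e(1)]] ij e 1 by auto
    moreover have "(f \<circ> transpose i j) ((repl i j \<circ> \<tau>) l) = f0 l" if "l < n" "l \<noteq> i0" for l
      using that \<tau>[OF that] k 1 by (auto simp: repl_def transpose_def)
    ultimately show ?thesis unfolding flow_def by blast
  next
    case 2
    obtain e where e: "ultra e" "d i j \<in> e" "near i a e" "near j e b"
      using swap False unfolding swap_def by metis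
    have "track i0 a0 (repl j i \<circ> \<tau>) b"
      using track.copy[OF track.move[OF track k e(1)]] ij e 2 diag_commute by auto
    moreover have "(f \<circ> transpose i j) ((repl j i \<circ> \<tau>) l) = f0 l" if "l < n" "l \<noteq> i0" for l
      using that \<tau>[OF that] k 2 by (auto simp: repl_def transpose_def)
    ultimately show ?thesis unfolding flow_def by blast
  next
    case 3
    obtain e1 e2 e3 where e: "ultra e1" "ultra e2" "ultra e3" "d j k \<in> e1" "d i j \<in> e2" "d k i \<in> e3"
        "near k a e1" "near j e1 e2" "near i e2 e3" "near k e3 b"
      using swap False k 3 unfolding swap_def by metis
    have "track i0 a0 \<tau> e1" using track.move track k e by blast
    then have "track i0 a0 (repl j k \<circ> \<tau>) e2" using track.copy k ij e 3 by metis
    then have "track i0 a0 (repl i j \<circ> (repl j k \<circ> \<tau>)) e3" using track.copy k ij e 3 by metis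
    then have "track i0 a0 (repl k i \<circ> (repl i j \<circ> (repl j k \<circ> \<tau>))) b" using track.copy k ij e 3 by metis
    moreover have "(f \<circ> transpose i j) ((repl k i \<circ> (repl i j \<circ> (repl j k \<circ> \<tau>))) l) = f0 l"
      if "l < n" "l \<noteq> i0" for l
    proof -
      have "\<tau> l \<noteq> k" using k that by auto
      then have "transpose i j ((repl k i \<circ> (repl i j \<circ> (repl j k \<circ> \<tau>))) l) = \<tau> l"
        using 3 ij(3) by (auto simp: repl_def transpose_def)
      then show ?thesis using \<tau>[OF that] by simp
    qed
    ultimately show ?thesis unfolding flow_def by blast
  qed
qed

text \<open>Permutations are composed of transpositions. The label \<open>b\<close> of \<open>f \<circ> \<pi>\<close> depends on the decomposition and on
choices on the way, so this is a relation.\<close>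
inductive link :: "'a set \<Rightarrow> (nat \<Rightarrow> nat) \<Rightarrow> 'a set \<Rightarrow> bool" for a where
  id: "link a id a"
| swap: "link a \<pi> b \<Longrightarrow> swap i j b c \<Longrightarrow> link a (\<pi> \<circ> transpose i j) c"

lemma link_ultra: "link a \<pi> b \<Longrightarrow> ultra a \<Longrightarrow> ultra b"
  by (induction rule: link.induct) (auto simp: swap_def)

lemma link_fits:
  assumes "link a \<pi> b" "fits f a"
  shows "fits (f \<circ> \<pi>) b"
  using assms(1)
proof induction
  case (swap \<pi> b i j c)
  from swap_fits[OF swap.IH swap.hyps(2)] show ?case unfolding comp_assoc .
qed (use assms(2) in simp)

lemma flow_link:
  assumes "link a \<pi> b" "flow i0 f0 a0 f a" "fits f a" "i0 < n"
  shows "flow i0 f0 a0 (f \<circ> \<pi>) b"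
  using assms(1)
proof induction
  case (swap \<pi> b i j c)
  from flow_swap[OF swap.IH link_fits[OF swap.hyps(1) assms(3)] swap.hyps(2) assms(4)]
  show ?case unfolding comp_assoc .
qed (use assms(2) in simp)

lemma flow_link_back:
  assumes "link a \<pi> b" "flow i0 f0 a0 (f \<circ> \<pi>) b" "fits f a" "i0 < n"
  shows "flow i0 f0 a0 f a"
  using assms(1,2)
proof induction
  case (swap \<pi> b i j c)
  have "fits (f \<circ> (\<pi> \<circ> transpose i j)) c"
    using link_fits[OF link.swap[OF swap.hyps] assms(3)] .
  from flow_swap[OF swap.prems this swap_sym[OF swap.hyps(2)] assms(4)]
  have "flow i0 f0 a0 (f \<circ> \<pi>) b"
    unfolding comp_assoc transpose_commute[of j i] transpose_comp_involutory comp_id .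
  then show ?case by (rule swap.IH)
qed simp

text \<open>Nearness read off from substitutions: \<open>s\<^sup>i\<^sub>j (F x) \<in> b\<close> for all \<open>x \<in> a\<close> gives one ultrafilter near \<open>b\<close> at
\<open>i\<close> that contains all \<open>F x\<close>, because the elements \<open>F x \<cdot> d\<^sub>i\<^sub>j\<close> are directed downwards.\<close>
lemma sub_extend:
  assumes a: "ultra a" and b: "ultra b" and ij: "i < n" "j < n" "i \<noteq> j"
    and F: "\<And>x. x \<in> C \<Longrightarrow> F x \<in> C" "\<And>x y. x \<in> C \<Longrightarrow> y \<in> C \<Longrightarrow> x \<sqsubseteq> y \<Longrightarrow> F x \<sqsubseteq> F y"
    and sub: "\<And>x. x \<in> a \<Longrightarrow> sub A i j (F x) \<in> b"
  shows "\<exists>e. ultra e \<and> d i j \<in> e \<and> near i e b \<and> (\<forall>x\<in>a. F x \<in> e)"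
proof -
  define Z where "Z = (\<lambda>x. F x \<sqinter> d i j) ` a"
  have aC: "x \<in> C" if "x \<in> a" for x using a that ultra_carrier by blast
  have FC: "F x \<in> C" if "x \<in> a" for x using F(1) aC that by blast
  have "\<exists>e. ultra e \<and> Z \<subseteq> e \<and> near i e b"
  proof (rule near_extend[OF b ij(1)])
    show "Z \<subseteq> C" using FC ij by (auto simp: Z_def)
    show "Z \<noteq> {}" using ultra_one[OF a] by (auto simp: Z_def)
    show "cyl A i z \<in> b" if "z \<in> Z" for z using that sub ij by (auto simp: Z_def sub_def)
    fix y z assume "y \<in> Z" "z \<in> Z"
    then obtain u v where uv: "u \<in> a" "v \<in> a" "y = F u \<sqinter> d i j" "z = F v \<sqinter> d i j"
      by (auto simp: Z_def)
    have le: "F (u \<sqinter> v) \<sqsubseteq> F u" "F (u \<sqinter> v) \<sqsubseteq> F v"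
      using uv aC F(2) meet_le1 meet_le2 by (metis closed(4))+
    have uvC: "u \<sqinter> v \<in> a" using uv a ultra_meetI by blast
    have "F (u \<sqinter> v) \<sqinter> d i j \<sqsubseteq> y" "F (u \<sqinter> v) \<sqinter> d i j \<sqsubseteq> z"
      using le uvC uv FC ij le_refl by (auto intro!: meet_mono)
    then show "\<exists>w\<in>Z. w \<sqsubseteq> y \<and> w \<sqsubseteq> z" using uvC by (auto simp: Z_def)
  qed
  then obtain e where e: "ultra e" "Z \<subseteq> e" "near i e b" by blast
  have "F x \<in> e \<and> d i j \<in> e" if "x \<in> a" for x
  proof -
    have "F x \<sqinter> d i j \<in> e" using e(2) that by (auto simp: Z_def)
    then show ?thesis using ultra_meet_iff[OF e(1)] FC[OF that] ij by simp
  qed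
  then show ?thesis using e ultra_one[OF a] by blast
qed

text \<open>The elements \<open>G x\<close> for \<open>x \<in> a\<close> are directed downwards, and they are nonzero since
\<open>c\<^sub>i c\<^sub>j (G x) \<in> a\<close>; this is what (Ax11) and (Ax12) provide.\<close>
lemma ultra_of_cyl_cyl:
  assumes a: "ultra a" and ij: "i < n" "j < n"
    and G: "\<And>x. x \<in> C \<Longrightarrow> G x \<in> C" "\<And>x y. x \<in> C \<Longrightarrow> y \<in> C \<Longrightarrow> x \<sqsubseteq> y \<Longrightarrow> G x \<sqsubseteq> G y"
    and pos: "\<And>x. x \<in> a \<Longrightarrow> cyl A i (cyl A j (G x)) \<in> a"
  shows "\<exists>b. ultra b \<and> (\<forall>x\<in>a. G x \<in> b)"
proof -
  define D where "D = {z \<in> C. \<exists>x\<in>a. G x \<sqsubseteq> z}"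
  have D_iff: "z \<in> D \<longleftrightarrow> z \<in> C \<and> (\<exists>x\<in>a. G x \<sqsubseteq> z)" for z by (simp add: D_def)
  have aC: "x \<in> C" if "x \<in> a" for x using a that ultra_carrier by blast
  have in_D: "G x \<in> D" if "x \<in> a" for x
    using G(1)[OF aC[OF that]] le_refl that D_iff by blast
  have D_zero: "zero A \<notin> D"
  proof
    assume "zero A \<in> D"
    then obtain x where x: "x \<in> a" "G x \<sqsubseteq> zero A" using D_iff by blast
    then have "G x = zero A" using le_zero G(1) aC by blast
    then have "zero A \<in> a" using pos[OF x(1)] cyl_zero ij by simp
    then show False using a ultra_zero by blast
  qed
  have D_meet: "z \<sqinter> z' \<in> D" if zz: "z \<in> D" "z' \<in> D" for z z'
  proof -
    obtain x x' where x: "x \<in> a" "x' \<in> a" "G x \<sqsubseteq> z" "G x' \<sqsubseteq> z'" "z \<in> C" "z' \<in> C"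
      using zz D_iff by metis
    have C: "x \<in> C" "x' \<in> C" "x \<sqinter> x' \<in> C" "x \<sqinter> x' \<in> a" using x aC a ultra_meetI by simp_all
    have "G (x \<sqinter> x') \<sqsubseteq> G x" "G (x \<sqinter> x') \<sqsubseteq> G x'" using C G(2) meet_le1 meet_le2 by blast+
    then have "G (x \<sqinter> x') \<sqsubseteq> z" "G (x \<sqinter> x') \<sqsubseteq> z'" using x C G(1) le_trans by blast+
    then have "G (x \<sqinter> x') \<sqsubseteq> z \<sqinter> z'" using x C G(1) le_meet by blast
    then show ?thesis using D_iff x C by (meson closed(4))
  qed
  have "D \<noteq> {}" "D \<subseteq> C" using in_D ultra_one[OF a] D_iff by auto
  then obtain b where "ultra b" "D \<subseteq> b" using ultra_extend[OF _ _ D_zero D_meet] by blast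
  then show ?thesis using in_D by blast
qed

text \<open>The chain is built from \<open>b\<close> back to \<open>a\<close>, peeling off one substitution at a time.\<close>
lemma chain_extend:
  assumes a: "ultra a" and b: "ultra b" and ijk: "i < n" "j < n" "i \<noteq> j" "k < n" "k \<noteq> i" "k \<noteq> j"
    and sub: "\<And>x. x \<in> a \<Longrightarrow> sub A k i (sub A i j (sub A j k (cyl A k x))) \<in> b"
  shows "\<exists>e1 e2 e3. ultra e1 \<and> ultra e2 \<and> ultra e3 \<and> d j k \<in> e1 \<and> d i j \<in> e2 \<and> d k i \<in> e3 \<and>
        near k a e1 \<and> near j e1 e2 \<and> near i e2 e3 \<and> near k e3 b"
proof -
  have "\<exists>e3. ultra e3 \<and> d k i \<in> e3 \<and> near k e3 b \<and> (\<forall>x\<in>a. sub A i j (sub A j k (cyl A k x)) \<in> e3)"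
    using ijk sub by (intro sub_extend[OF a b]) (auto intro!: sub_mono cyl_mono)
  then obtain e3 where e3: "ultra e3" "d k i \<in> e3" "near k e3 b"
    "\<And>x. x \<in> a \<Longrightarrow> sub A i j (sub A j k (cyl A k x)) \<in> e3" by blast
  have "\<exists>e2. ultra e2 \<and> d i j \<in> e2 \<and> near i e2 e3 \<and> (\<forall>x\<in>a. sub A j k (cyl A k x) \<in> e2)"
    using ijk e3(4) by (intro sub_extend[OF a e3(1)]) (auto intro!: sub_mono cyl_mono)
  then obtain e2 where e2: "ultra e2" "d i j \<in> e2" "near i e2 e3"
    "\<And>x. x \<in> a \<Longrightarrow> sub A j k (cyl A k x) \<in> e2" by blast
  have "\<exists>e1. ultra e1 \<and> d j k \<in> e1 \<and> near j e1 e2 \<and> (\<forall>x\<in>a. cyl A k x \<in> e1)"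
    using ijk e2(4) by (intro sub_extend[OF a e2(1)]) (auto intro!: cyl_mono)
  then obtain e1 where "ultra e1" "d j k \<in> e1" "near j e1 e2" "near k a e1"
    unfolding near_def by blast
  then show ?thesis using e2 e3 by blast
qed

lemma swapI:
  assumes a: "ultra a" and b: "ultra b" and ij: "i < n" "j < n" "i \<noteq> j" and d: "d i j \<notin> a" "d i j \<notin> b"
    and sub: "\<And>x. x \<in> a \<Longrightarrow> sub A i j (cyl A j x) \<in> b" "\<And>x. x \<in> a \<Longrightarrow> sub A j i (cyl A i x) \<in> b"
    and chain: "\<And>k x. k < n \<Longrightarrow> k \<noteq> i \<Longrightarrow> k \<noteq> j \<Longrightarrow> x \<in> a \<Longrightarrow>
      sub A k i (sub A i j (sub A j k (cyl A k x))) \<in> b"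
  shows "swap i j a b"
proof -
  have "\<exists>e. ultra e \<and> d i j \<in> e \<and> near i e b \<and> (\<forall>x\<in>a. cyl A j x \<in> e)"
    using ij sub by (intro sub_extend[OF a b]) (auto intro!: cyl_mono)
  then have e: "\<exists>e. ultra e \<and> d i j \<in> e \<and> near j a e \<and> near i e b"
    unfolding near_def by blast
  have "\<exists>e. ultra e \<and> d j i \<in> e \<and> near j e b \<and> (\<forall>x\<in>a. cyl A i x \<in> e)"
    using ij sub by (intro sub_extend[OF a b]) (auto intro!: cyl_mono)
  then have e': "\<exists>e. ultra e \<and> d i j \<in> e \<and> near i a e \<and> near j e b"
    unfolding near_def using diag_commute[OF ij(1,2)] by metis
  show ?thesis
    unfolding swap_def using a b ij d e e' chain_extend[OF a b ij _ _ _ chain] by simp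
qed

lemma swap_exists_dim_2:
  assumes "n = 2" "ax11 A" and a: "ultra a" and ij: "i < n" "j < n" "i \<noteq> j"
  shows "\<exists>b. swap i j a b"
proof (cases "d i j \<in> a")
  case True
  then show ?thesis using a ij by (auto simp: swap_def)
next
  case False
  have d_eq: "d 0 1 = d i j"
    using ij assms(1) diag_commute[of 0 1] by (auto simp: less_2_cases_iff)
  define G where "G x = (compl A (d 0 1) \<sqinter> sub A 0 1 (cyl A 1 x)) \<sqinter> sub A 1 0 (cyl A 0 x)" for x
  have n: "0 < n" "1 < n" using assms(1) by auto
  have GC: "G x \<in> C" if "x \<in> C" for x using that n by (simp add: G_def)
  have "\<exists>b. ultra b \<and> (\<forall>x\<in>a. G x \<in> b)"
  proof (rule ultra_of_cyl_cyl[OF a n GC])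
    show "G x \<sqsubseteq> G y" if "x \<in> C" "y \<in> C" "x \<sqsubseteq> y" for x y
      unfolding G_def using that n by (intro meet_mono sub_mono cyl_mono le_refl) auto
    fix x assume x: "x \<in> a"
    then have xC: "x \<in> C" using a ultra_carrier by blast
    have "compl A (d 0 1) \<in> a" unfolding d_eq using False ultra_compl_iff[OF a] ij by simp
    then have "x \<sqinter> compl A (d 0 1) \<in> a" using x a ultra_meetI by blast
    moreover have "x \<sqinter> compl A (d 0 1) \<sqsubseteq> cyl A 0 (cyl A 1 (G x))"
      using assms(2) xC unfolding ax11_def G_def by blast
    ultimately show "cyl A 0 (cyl A 1 (G x)) \<in> a" using ultra_up[OF a] GC[OF xC] n by simp
  qed
  then obtain b where b: "ultra b" and Gb: "\<And>x. x \<in> a \<Longrightarrow> G x \<in> b" by blast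
  have parts: "compl A (d 0 1) \<in> b \<and> sub A 0 1 (cyl A 1 x) \<in> b \<and> sub A 1 0 (cyl A 0 x) \<in> b" if "x \<in> a" for x
    using Gb[OF that] ultra_carrier[OF a that] n ultra_meet_iff[OF b] by (simp add: G_def)
  have "d i j \<notin> b" using parts[OF ultra_one[OF a]] ultra_compl_iff[OF b] ij unfolding d_eq by simp
  moreover have "sub A i j (cyl A j x) \<in> b" "sub A j i (cyl A i x) \<in> b" if "x \<in> a" for x
    using parts[OF that] ij assms(1) by (auto simp: less_2_cases_iff)
  ultimately have "swap i j a b"
    using ij assms(1) False by (intro swapI[OF a b]) auto
  then show ?thesis by blast
qed

text \<open>For \<open>d\<^sub>i\<^sub>j \<notin> b\<close>, which is part of (Ax11) but not of (Ax12), a third index \<open>k\<close> is used: along the chain with buffer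
\<open>k\<close>, the equality of entries \<open>i\<close> and \<open>j\<close> would be transported from \<open>b\<close> back to \<open>a\<close>.\<close>
lemma swap_exists_dim_ge_3:
  assumes "n \<ge> 3" "ax12 n A" and a: "ultra a" and ij: "i < n" "j < n" "i \<noteq> j"
  shows "\<exists>b. swap i j a b"
proof (cases "d i j \<in> a")
  case True
  then show ?thesis using a ij by (auto simp: swap_def)
next
  case False
  define H where "H x k = sub A k i (sub A i j (sub A j k (cyl A k x)))" for x k
  define K where "K = {..<n} - {i, j}"
  define G where "G x = (sub A i j (cyl A j x) \<sqinter> sub A j i (cyl A i x)) \<sqinter> big_meet A (H x) K" for x
  have K: "finite K" "\<And>k. k \<in> K \<Longrightarrow> k < n \<and> k \<noteq> i \<and> k \<noteq> j" by (auto simp: K_def)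
  have HC: "H x k \<in> C" if "x \<in> C" "k \<in> K" for x k using that ij K by (simp add: H_def)
  have BC: "big_meet A (H x) K \<in> C" if "x \<in> C" for x using big_meet_in(1)[OF a K(1)] HC that by blast
  have GC: "G x \<in> C" if "x \<in> C" for x using that ij BC by (simp add: G_def)
  have G_iff: "G x \<in> U \<longleftrightarrow> sub A i j (cyl A j x) \<in> U \<and> sub A j i (cyl A i x) \<in> U \<and> (\<forall>k\<in>K. H x k \<in> U)"
    if "ultra U" "x \<in> C" for U x
    unfolding G_def using that ij BC HC K ultra_meet_iff[OF that(1)] big_meet_in(2)[OF that(1) K(1)]
    by (simp)
  have "\<exists>b. ultra b \<and> (\<forall>x\<in>a. G x \<in> b)"
  proof (rule ultra_of_cyl_cyl[OF a ij(1,2) GC])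
    show "G x \<sqsubseteq> G y" if xy: "x \<in> C" "y \<in> C" "x \<sqsubseteq> y" for x y
    proof (rule ccontr)
      assume "\<not> G x \<sqsubseteq> G y"
      then obtain U where U: "ultra U" "G x \<in> U" "G y \<notin> U" using ultra_separates GC xy by blast
      have up: "z' \<in> U" if "z \<in> U" "z \<sqsubseteq> z'" "z' \<in> C" for z z' using ultra_up U that by blast
      have "H x k \<sqsubseteq> H y k" if "k \<in> K" for k
        unfolding H_def using xy ij K(2)[OF that] by (intro sub_mono cyl_mono) auto
      moreover have "sub A i j (cyl A j x) \<sqsubseteq> sub A i j (cyl A j y)" "sub A j i (cyl A i x) \<sqsubseteq> sub A j i (cyl A i y)"
        using xy ij by (auto intro!: sub_mono cyl_mono)
      ultimately have "G y \<in> U"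
        using U(2) xy ij HC up unfolding G_iff[OF U(1) xy(1)] G_iff[OF U(1) xy(2)] by (meson closed(6) sub_closed)
      then show False using U by blast
    qed
    fix x assume x: "x \<in> a"
    then have xC: "x \<in> C" using a ultra_carrier by blast
    have "x \<sqsubseteq> cyl A i (cyl A j (G x))"
      using assms(2) xC ij unfolding ax12_def G_def H_def K_def by blast
    then show "cyl A i (cyl A j (G x)) \<in> a" using ultra_up[OF a x] GC[OF xC] ij by simp
  qed
  then obtain b where b: "ultra b" and Gb: "\<And>x. x \<in> a \<Longrightarrow> G x \<in> b" by blast
  have parts: "sub A i j (cyl A j x) \<in> b" "sub A j i (cyl A i x) \<in> b" "\<And>k. k \<in> K \<Longrightarrow> H x k \<in> b"
    if "x \<in> a" for x
    using Gb[OF that] G_iff[OF b ultra_carrier[OF a that]] by auto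
  have "card K > 0" using ij assms(1) by (simp add: K_def card_Diff_subset)
  then obtain k where k: "k \<in> K" by fastforce
  then have kn: "k < n" "k \<noteq> i" "k \<noteq> j" using K(2) by auto
  have "\<exists>e1 e2 e3. ultra e1 \<and> ultra e2 \<and> ultra e3 \<and> d j k \<in> e1 \<and> d i j \<in> e2 \<and> d k i \<in> e3 \<and>
      near k a e1 \<and> near j e1 e2 \<and> near i e2 e3 \<and> near k e3 b"
    using parts(3)[OF _ k] by (intro chain_extend[OF a b ij kn]) (simp add: H_def)
  then obtain e1 e2 e3 where e: "ultra e1" "ultra e2" "ultra e3" "d j k \<in> e1" "d i j \<in> e2" "d k i \<in> e3"
    "near k a e1" "near j e1 e2" "near i e2 e3" "near k e3 b" by blast
  have "d i j \<notin> b"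
  proof
    assume "d i j \<in> b"
    then have "d i j \<in> e3" using near_diag[OF e(3) b kn(1) e(10) ij(1,2)] kn by simp
    then have "d k j \<in> e3" using diag_trans[OF e(3)] e(6) ij kn by blast
    then have "d k j \<in> e2" using near_diag[OF e(2,3) ij(1) e(9)] ij kn by simp
    then have "d i k \<in> e2" using diag_trans[OF e(2)] e(5) ij kn diag_commute by metis
    then have "d i k \<in> e1" using near_diag[OF e(1,2) ij(2) e(8)] ij kn by simp
    then have "d i j \<in> e1" using diag_trans[OF e(1)] e(4) ij kn diag_commute by metis
    then show False using near_diag[OF a e(1) kn(1) e(7) ij(1,2)] kn False by simp
  qed
  then have "swap i j a b"
    using ij False parts by (intro swapI[OF a b]) (auto simp: H_def K_def)
  then show ?thesis by blast
qed

lemma link_exists: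
  assumes swaps: "\<And>a i j. ultra a \<Longrightarrow> i < n \<Longrightarrow> j < n \<Longrightarrow> i \<noteq> j \<Longrightarrow> \<exists>b. swap i j a b"
    and "\<pi> permutes {..<n}" and a: "ultra a"
  shows "\<exists>b. link a \<pi> b"
  using finite_lessThan assms(2)
proof (induction rule: permutes_rev_induct)
  case id
  show ?case using link.id by blast
next
  case (swap i j \<pi>)
  then obtain b where b: "link a \<pi> b" by blast
  then obtain c where "swap i j b c" using swaps link_ultra a swap by (meson lessThan_iff)
  then show ?case using link.swap b by blast
qed

end

section \<open>The tree of labelled sequences\<close>
text \<open>A path is the history of a sequence, the most recent step first. A step is the new label together with a number that
codes the index of the changed entry and a permutation applied before the change. Paths are also the elements of
the base.\<close>
type_synonym 'a path = "('a set \<times> nat) list"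

text \<open>\<open>dir\<close> and \<open>turn\<close> decode the numbers in a path, and \<open>twist a \<pi>\<close> is the label chosen for \<open>f \<circ> \<pi>\<close> when \<open>f\<close> has
label \<open>a\<close>. Leaving the set of permutations open allows treating RC and DC, with the identity only, together
with SC, with all permutations.\<close>
locale rc_tree = rc_algebra +
  fixes dir :: "nat \<Rightarrow> nat" and turn :: "nat \<Rightarrow> nat \<Rightarrow> nat"
    and twist :: "'a set \<Rightarrow> (nat \<Rightarrow> nat) \<Rightarrow> 'a set"
  assumes dir_less: "dir s < n"
    and code: "i < n \<Longrightarrow> \<exists>t. dir t = i \<and> turn t = turn s"
    and turn_id: "\<exists>s. turn s = id"
    and turn_permutes: "turn s permutes {..<n}"
    and turn_comp: "\<exists>u. turn u = turn s \<circ> turn t"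
    and twist_link: "ultra a \<Longrightarrow> link a (turn s) (twist a (turn s))"
    and twist_id: "ultra a \<Longrightarrow> twist a id = a"
begin

fun lab :: "'a path \<Rightarrow> 'a set" where
  "lab [] = {}"
| "lab ((a, s) # w) = a"

text \<open>The diagonals in \<open>b\<close> may force the entry at \<open>i\<close> to be equal to another one. Any such \<open>j\<close> gives the same value
if \<open>f\<close> has a label near \<open>b\<close> at \<open>i\<close>.\<close>
definition new_entry :: "(nat \<Rightarrow> 'b) \<Rightarrow> nat \<Rightarrow> 'a set \<Rightarrow> 'b \<Rightarrow> 'b" where
  "new_entry f i b u = (if \<exists>j<n. j \<noteq> i \<and> d i j \<in> b then f (SOME j. j < n \<and> j \<noteq> i \<and> d i j \<in> b) else u)"

lemma new_entry_cases:
  obtains (old) j where "j < n" "j \<noteq> i" "d i j \<in> b" "new_entry f i b u = f j"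
  | (new) "\<And>j. j < n \<Longrightarrow> j \<noteq> i \<Longrightarrow> d i j \<notin> b" "new_entry f i b u = u"
proof (cases "\<exists>j<n. j \<noteq> i \<and> d i j \<in> b")
  case True
  define j where "j = (SOME j. j < n \<and> j \<noteq> i \<and> d i j \<in> b)"
  have "j < n \<and> j \<noteq> i \<and> d i j \<in> b" unfolding j_def by (rule someI_ex[OF True])
  moreover have "new_entry f i b u = f j" using True by (simp add: new_entry_def j_def)
  ultimately show ?thesis using old by blast
next
  case False
  show ?thesis by (rule new) (use False in \<open>auto simp: new_entry_def\<close>)
qed

text \<open>In an initial sequence, equal entries are identified through the least index of their class. All its entries are
lists of length 1. A later fresh element is the current path, a list of length at least 2 that occurs nowhere
before.\<close>
fun seq :: "'a path \<Rightarrow> nat \<Rightarrow> 'a base" where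
  "seq [] = (\<lambda>k. undefined)"
| "seq [(a, s)] = (\<lambda>k. if k < n then [(a, LEAST l. l < n \<and> d k l \<in> a)] else undefined)"
| "seq ((b, s) # w) = (seq w \<circ> turn s)(dir s := new_entry (seq w \<circ> turn s) (dir s) b ((b, s) # w))"

lemma seq_Cons: "w \<noteq> [] \<Longrightarrow>
    seq ((b, s) # w) = (seq w \<circ> turn s)(dir s := new_entry (seq w \<circ> turn s) (dir s) b ((b, s) # w))"
  by (cases w) simp_all

text \<open>Steps that would keep the label are excluded. They are superfluous, and an injective sequence
would otherwise be reached by several paths with different labels.\<close>
definition step_ok :: "'a set \<Rightarrow> nat \<Rightarrow> 'a path \<Rightarrow> bool" where
  "step_ok b s w \<longleftrightarrow> ultra b \<and> near (dir s) (twist (lab w) (turn s)) b \<and> b \<noteq> twist (lab w) (turn s)"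

inductive valid :: "'a path \<Rightarrow> bool" where
  root: "ultra a \<Longrightarrow> valid [(a, 0)]"
| step: "valid w \<Longrightarrow> step_ok b s w \<Longrightarrow> valid ((b, s) # w)"

lemma valid_nonempty: "valid w \<Longrightarrow> w \<noteq> []"
  by (induction rule: valid.induct) auto

lemma valid_ultra: "valid w \<Longrightarrow> ultra (lab w)"
  by (induction rule: valid.induct) (auto simp: step_ok_def)

lemma twist_ultra: "valid w \<Longrightarrow> ultra (twist (lab w) (turn s))"
  using twist_link link_ultra valid_ultra by blast

lemma turn_less_iff [simp]: "turn s k < n \<longleftrightarrow> k < n"
  using permutes_in_image[OF turn_permutes] by simp

lemma turn_image: "turn s ` {..<n} = {..<n}"
  using permutes_image[OF turn_permutes] .

lemma turn_image_seq: "(seq w \<circ> turn s) ` {..<n} = seq w ` {..<n}"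
  by (metis image_comp turn_image)

text \<open>Every base element names its time of creation by its length. At that time, it determines the whole path, or at
least the root.\<close>
lemma seq_values:
  assumes "valid w" "x \<in> seq w ` {..<n}"
  shows "length x \<le> length w \<and> 1 \<le> length x \<and>
    (length x = length w \<and> 1 < length w \<longrightarrow> x = w) \<and> (length x = 1 \<longrightarrow> fst (hd x) = fst (last w))"
  using assms
proof (induction arbitrary: x rule: valid.induct)
  case (root a)
  then show ?case by auto
next
  case (step w b s)
  have w: "w \<noteq> []" using step valid_nonempty by blast
  obtain k where k: "k < n" "x = seq ((b, s) # w) k" using step.prems by auto
  have "x \<in> (seq w \<circ> turn s) ` {..<n} \<or> x = (b, s) # w"
  proof (cases "k = dir s")
    case True
    then have x: "x = new_entry (seq w \<circ> turn s) (dir s) b ((b, s) # w)" using k w by (simp add: seq_Cons)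
    show ?thesis
      by (rule new_entry_cases[of "dir s" b "seq w \<circ> turn s" "(b, s) # w"]) (use x in auto)
  next
    case False
    then show ?thesis using k w by (auto simp: seq_Cons)
  qed
  then have "x \<in> seq w ` {..<n} \<or> x = (b, s) # w" unfolding turn_image_seq .
  then show ?case
    using step.IH[of x] w by (auto simp: Suc_le_eq)
qed

lemma seq_extensional: "valid w \<Longrightarrow> \<not> k < n \<Longrightarrow> seq w k = undefined"
proof (induction rule: valid.induct)
  case (step w b s)
  then show ?case
    using dir_less[of s] valid_nonempty permutes_not_in[OF turn_permutes, of k s] by (auto simp: seq_Cons)
qed simp

lemma fits_root: "ultra a \<Longrightarrow> fits (seq [(a, s)]) a"
proof -
  assume a: "ultra a"
  let ?L = "\<lambda>k. LEAST l. l < n \<and> d k l \<in> a"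
  have L: "?L k < n \<and> d k (?L k) \<in> a" if "k < n" for k
    using LeastI[of "\<lambda>l. l < n \<and> d k l \<in> a" k] that diag_refl[OF a that] by blast
  have "?L k = ?L l \<longleftrightarrow> d k l \<in> a" if kl: "k < n" "l < n" for k l
  proof
    assume "?L k = ?L l"
    then show "d k l \<in> a" using L[OF kl(1)] L[OF kl(2)] diag_trans[OF a] diag_commute kl by metis
  next
    assume "d k l \<in> a"
    then have "d k m \<in> a \<longleftrightarrow> d l m \<in> a" if "m < n" for m
      using diag_trans[OF a] diag_commute kl that by metis
    then have "(\<lambda>m. m < n \<and> d k m \<in> a) = (\<lambda>m. m < n \<and> d l m \<in> a)" by blast
    then show "?L k = ?L l" by simp
  qed
  then show ?thesis by (simp add: fits_def)
qed

text \<open>The equivalence of entries under \<open>b\<close> differs from that under the previous label only at \<open>dir s\<close>. The entry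
there really changes: if it kept its value by being copied from \<open>j\<close>, both labels would contain the diagonal of
\<open>dir s\<close> and \<open>j\<close>, and they would be equal by (Ax6).\<close>
lemma
  assumes w: "valid w" and fit: "fits (seq w) (lab w)" and ok: "step_ok b s w"
  shows fits_step: "fits (seq ((b, s) # w)) b"
    and step_agree: "agree_off n (dir s) (seq w \<circ> turn s) (seq ((b, s) # w))"
    and step_neq: "seq ((b, s) # w) (dir s) \<noteq> seq w (turn s (dir s))"
    and step_image: "seq ((b, s) # w) ` {..<n} \<subseteq> insert ((b, s) # w) (seq w ` {..<n})"
proof -
  let ?f = "seq w \<circ> turn s" and ?g = "seq ((b, s) # w)" and ?i = "dir s"
    and ?a = "twist (lab w) (turn s)"
  let ?e = "new_entry ?f ?i b ((b, s) # w)"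
  have i: "?i < n" using dir_less .
  have g: "?g = ?f(?i := ?e)" using seq_Cons valid_nonempty[OF w] by simp
  have a: "ultra ?a" and b: "ultra b" and near: "near ?i ?a b" and neq: "b \<noteq> ?a"
    using ok twist_ultra[OF w] unfolding step_ok_def by simp_all
  have f_fit: "fits ?f ?a" by (rule link_fits[OF twist_link[OF valid_ultra[OF w]] fit])
  have new: "(b, s) # w \<notin> ?f ` {..<n}"
    unfolding turn_image_seq using seq_values[OF w, of "(b, s) # w"] by auto
  have off: "?g k = ?f k" if "k \<noteq> ?i" for k using g that by simp
  have old: "?f k = ?f l \<longleftrightarrow> d k l \<in> b" if "k < n" "l < n" "k \<noteq> ?i" "l \<noteq> ?i" for k l
    using near_diag[OF a b i near] f_fit that unfolding fits_def by metis
  have at_i: "?g ?i = ?f l \<longleftrightarrow> d ?i l \<in> b" if l: "l < n" "l \<noteq> ?i" for l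
  proof (rule new_entry_cases[of ?i b ?f "(b, s) # w"])
    fix j assume j: "j < n" "j \<noteq> ?i" "d ?i j \<in> b" "?e = ?f j"
    then have "?g ?i = ?f j" using g by simp
    also have "?f j = ?f l \<longleftrightarrow> d j l \<in> b" using old j l by blast
    also have "\<dots> \<longleftrightarrow> d ?i l \<in> b"
      using j diag_trans[OF b] diag_commute i l by metis
    finally show ?thesis .
  next
    assume new_e: "\<And>j. j < n \<Longrightarrow> j \<noteq> ?i \<Longrightarrow> d ?i j \<notin> b" "?e = (b, s) # w"
    then have "?g ?i = (b, s) # w" using g by simp
    moreover have "?f l \<noteq> (b, s) # w" using new l by (metis imageI lessThan_iff)
    ultimately show ?thesis using new_e l by metis
  qed
  show "agree_off n ?i ?f ?g" using off by (simp add: agree_off_def)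
  show "fits ?g b"
    unfolding fits_def
  proof (intro allI impI)
    fix k l assume kl: "k < n" "l < n"
    show "?g k = ?g l \<longleftrightarrow> d k l \<in> b"
      using old[OF kl] at_i[of k] at_i[of l] off[of k] off[of l] kl diag_refl[OF b i] diag_commute[OF kl]
      by metis
  qed
  show "?g ?i \<noteq> seq w (turn s ?i)"
  proof (rule new_entry_cases[of ?i b ?f "(b, s) # w"])
    fix j assume j: "j < n" "j \<noteq> ?i" "d ?i j \<in> b" "?e = ?f j"
    have "?f j \<noteq> ?f ?i"
    proof
      assume "?f j = ?f ?i"
      then have "d ?i j \<in> ?a" using f_fit j i unfolding fits_def by metis
      then show False using near_diag_eq[OF a b i _ _ near] j neq by metis
    qed
    then show ?thesis using g j by simp
  next
    assume "?e = (b, s) # w"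
    then have "?g ?i = (b, s) # w" using g by simp
    moreover have "?f ?i \<noteq> (b, s) # w" using new i by (metis imageI lessThan_iff)
    ultimately show ?thesis by simp
  qed
  have "?e \<in> insert ((b, s) # w) (?f ` {..<n})"
    by (rule new_entry_cases[of ?i b ?f "(b, s) # w"]) auto
  then have "?g ` {..<n} \<subseteq> insert ((b, s) # w) (?f ` {..<n})"
    unfolding g by auto
  then show "?g ` {..<n} \<subseteq> insert ((b, s) # w) (seq w ` {..<n})"
    unfolding turn_image_seq .
qed

lemma valid_fits: "valid w \<Longrightarrow> fits (seq w) (lab w)"
proof (induction rule: valid.induct)
  case (root a)
  then show ?case using fits_root by simp
next
  case (step w b s)
  then show ?case using fits_step[OF step(1) step.IH step(2)] by simp
qed

lemma twist_fits: "valid w \<Longrightarrow> fits (seq w \<circ> turn s) (twist (lab w) (turn s))"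
  by (rule link_fits[OF twist_link[OF valid_ultra] valid_fits])

text \<open>The last step of the longer one of two paths cannot have created a shared value: a value is created on a
single path only, and the shorter or equally long path \<open>v\<close> contains no value created by the last step of \<open>w\<close>. So
shared values are already present one step earlier. For two roots, a shared value means that they
are equal.\<close>
lemma shared_old:
  assumes v: "valid v" and w: "valid w" and neq: "v \<noteq> w" and len: "length v \<le> length w"
    and keep: "S \<subseteq> seq v ` {..<n}" "S \<subseteq> seq w ` {..<n}" and S: "S \<noteq> {}"
  obtains b s w' where "w = (b, s) # w'" "valid w'" "step_ok b s w'" "S \<subseteq> seq w' ` {..<n}"
  using w
proof cases
  case (root a)
  then have "length v = 1" using len valid_nonempty[OF v] by (cases v) auto
  with v obtain c where c: "v = [(c, 0)]" by cases (auto dest: valid_nonempty)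
  obtain x where x: "x \<in> S" using S by blast
  have "length x = 1" "fst (hd x) = c"
    using seq_values[OF v, of x] x keep c by auto
  moreover have "fst (hd x) = a" if "length x = 1"
    using seq_values[OF w, of x] x keep root that by auto
  ultimately show ?thesis using neq c root by simp
next
  case (step w' b s)
  have "w \<notin> seq v ` {..<n}"
  proof
    assume "w \<in> seq v ` {..<n}"
    moreover have "1 < length w" using step valid_nonempty[OF step(2)] by simp
    ultimately have "w = v" using seq_values[OF v, of w] len by simp
    then show False using neq by simp
  qed
  moreover have "S \<subseteq> insert w (seq w' ` {..<n})"
    using step_image[OF step(2) valid_fits[OF step(2)] step(3)] keep(2) unfolding step(1) by (rule subset_trans[rotated])
  ultimately have "S \<subseteq> seq w' ` {..<n}" using keep(1) by blast
  then show ?thesis using that step by blast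
qed

lemma flow_forward:
  assumes flow: "flow i0 f0 a0 (seq w) (lab w)" and w: "valid w" and ok: "step_ok b s w"
    and i0: "i0 < n" and keep: "f0 ` ({..<n} - {i0}) \<subseteq> seq ((b, s) # w) ` {..<n}"
  shows "flow i0 f0 a0 (seq ((b, s) # w)) b"
proof (rule flow_step[OF _ twist_fits[OF w] _ dir_less _ _ _ keep])
  show "flow i0 f0 a0 (seq w \<circ> turn s) (twist (lab w) (turn s))"
    using flow_link[OF twist_link[OF valid_ultra[OF w]] flow valid_fits[OF w] i0] .
  show "seq ((b, s) # w) (dir s) \<noteq> (seq w \<circ> turn s) (dir s)"
    using step_neq[OF w valid_fits[OF w] ok] by simp
  show "agree_off n (dir s) (seq w \<circ> turn s) (seq ((b, s) # w))"
    using step_agree[OF w valid_fits[OF w] ok] .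
  show "ultra b" "near (dir s) (twist (lab w) (turn s)) b" using ok by (simp_all add: step_ok_def)
qed

lemma flow_backward:
  assumes flow: "flow i0 f0 a0 (seq ((b, s) # w)) b" and w: "valid w" and ok: "step_ok b s w"
    and i0: "i0 < n" and keep: "f0 ` ({..<n} - {i0}) \<subseteq> seq w ` {..<n}"
  shows "flow i0 f0 a0 (seq w) (lab w)"
proof -
  let ?a = "twist (lab w) (turn s)"
  have a: "ultra ?a" using twist_ultra w .
  have near: "near (dir s) b ?a" using ok near_sym[OF a] dir_less by (simp add: step_ok_def)
  have "flow i0 f0 a0 (seq w \<circ> turn s) ?a"
  proof (rule flow_step[OF flow _ a dir_less near])
    show "fits (seq ((b, s) # w)) b" using fits_step[OF w valid_fits[OF w] ok] .
    show "agree_off n (dir s) (seq ((b, s) # w)) (seq w \<circ> turn s)"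
      using agree_off_sym[OF step_agree[OF w valid_fits[OF w] ok]] .
    show "(seq w \<circ> turn s) (dir s) \<noteq> seq ((b, s) # w) (dir s)"
      using step_neq[OF w valid_fits[OF w] ok] by simp
    show "f0 ` ({..<n} - {i0}) \<subseteq> (seq w \<circ> turn s) ` {..<n}" using keep unfolding turn_image_seq .
  qed
  then show ?thesis by (rule flow_link_back[OF twist_link[OF valid_ultra[OF w]] _ valid_fits[OF w] i0])
qed

text \<open>One walks from \<open>w\<close> down to the common part of the two paths and up to \<open>v\<close>. All sequences on the way contain the tracked
values by \<open>shared_old\<close>, always applied to the longer path.\<close>
lemma flow_between:
  assumes "flow i0 f0 a0 (seq w) (lab w)" "valid w" "valid v" "i0 < n"
    "f0 ` ({..<n} - {i0}) \<subseteq> seq w ` {..<n}" "f0 ` ({..<n} - {i0}) \<subseteq> seq v ` {..<n}"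
  shows "flow i0 f0 a0 (seq v) (lab v)"
  using assms
proof (induction "length w + length v" arbitrary: w v rule: less_induct)
  case less
  let ?S = "f0 ` ({..<n} - {i0})"
  \<comment> \<open>At least one entry is tracked because \<open>n\<close> is at least 2; without a shared value the paths might have different roots.\<close>
  have "(if i0 = 0 then 1 else 0) \<in> {..<n} - {i0}" using dim by auto
  then have S: "?S \<noteq> {}" by blast
  consider "v = w" | "v \<noteq> w" "length v \<le> length w" | "v \<noteq> w" "length w \<le> length v" by linarith
  then show ?case
  proof cases
    case 1
    then show ?thesis using less.prems by simp
  next
    case 2
    obtain b s w' where w': "w = (b, s) # w'" "valid w'" "step_ok b s w'" "?S \<subseteq> seq w' ` {..<n}"
      using shared_old[OF less.prems(3,2) 2 less.prems(6,5) S] .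
    then have "flow i0 f0 a0 (seq w') (lab w')" using flow_backward less.prems by simp
    then show ?thesis using less.hyps[of w' v] w' less.prems by simp
  next
    case 3
    obtain b s v' where v': "v = (b, s) # v'" "valid v'" "step_ok b s v'" "?S \<subseteq> seq v' ` {..<n}"
      using shared_old[OF less.prems(2,3) _ 3(2) less.prems(5,6) S] 3 by metis
    then have "flow i0 f0 a0 (seq v') (lab v')" using less.hyps[of w v'] less.prems by simp
    then show ?thesis using flow_forward[of i0 f0 a0 v' b s] v' less.prems by simp
  qed
qed

lemma near_if_agree:
  assumes w: "valid w" and v: "valid v" and i: "i < n"
    and agree: "agree_off n i (seq w \<circ> turn s) (seq v \<circ> turn t)"
  shows "near i (twist (lab w) (turn s)) (twist (lab v) (turn t))"
proof -
  let ?f = "seq w \<circ> turn s" and ?a = "twist (lab w) (turn s)"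
  have "flow i ?f ?a (seq w) (lab w)"
    using flow_link_back[OF twist_link[OF valid_ultra[OF w]] flow_refl valid_fits[OF w] i] .
  moreover have "?f ` ({..<n} - {i}) \<subseteq> ?f ` {..<n}" by blast
  then have "?f ` ({..<n} - {i}) \<subseteq> seq w ` {..<n}" unfolding turn_image_seq .
  moreover have "?f k = (seq v \<circ> turn t) k" if "k \<in> {..<n} - {i}" for k
    using agree that unfolding agree_off_def by blast
  then have "?f ` ({..<n} - {i}) \<subseteq> (seq v \<circ> turn t) ` {..<n}"
    by (intro image_subsetI) (metis Diff_iff imageI)
  then have "?f ` ({..<n} - {i}) \<subseteq> seq v ` {..<n}" unfolding turn_image_seq .
  ultimately have "flow i ?f ?a (seq v) (lab v)" by (rule flow_between[OF _ w v i])
  then have "flow i ?f ?a (seq v \<circ> turn t) (twist (lab v) (turn t))"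
    by (rule flow_link[OF twist_link[OF valid_ultra[OF v]] _ valid_fits[OF v] i])
  then show ?thesis by (rule flow_near[OF _ twist_fits[OF v] twist_ultra[OF w] i agree])
qed

text \<open>By \<open>shared_old\<close>, all \<open>n\<close> values are present already before the last step of the longer path, so the sequence was
injective with the same values then. But a step that really changes an entry of an injective sequence
loses the value of this entry.\<close>
lemma injective_path_unique:
  assumes w: "valid w" and v: "valid v" and len: "length v \<le> length w"
    and inj: "inj_on (seq w) {..<n}" and same: "seq v ` {..<n} = seq w ` {..<n}"
  shows "v = w"
proof (rule ccontr)
  assume "v \<noteq> w"
  have "seq w 0 \<in> seq w ` {..<n}" using dim by simp
  then have "seq w ` {..<n} \<noteq> {}" by blast
  then obtain b s w' where w': "w = (b, s) # w'" "valid w'" "step_ok b s w'"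
      "seq w ` {..<n} \<subseteq> seq w' ` {..<n}"
    using shared_old[OF v w \<open>v \<noteq> w\<close> len _ order_refl] same by (metis order_refl)
  let ?f = "seq w' \<circ> turn s" and ?i = "dir s"
  have sub: "seq w ` {..<n} \<subseteq> ?f ` {..<n}" using w'(4) unfolding turn_image_seq .
  have card: "card (seq w ` {..<n}) = n" using inj by (simp add: card_image)
  moreover have "card (?f ` {..<n}) \<le> n" using card_image_le[of "{..<n}" ?f] by simp
  ultimately have eq: "seq w ` {..<n} = ?f ` {..<n}" using sub by (intro card_seteq) auto
  then have f_inj: "inj_on ?f {..<n}" using card by (intro eq_card_imp_inj_on) auto
  have "?f ?i \<in> seq w ` {..<n}" using eq dir_less by blast
  then obtain k where k: "k < n" "seq w k = ?f ?i" by auto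
  have "k \<noteq> ?i" using step_neq[OF w'(2) valid_fits[OF w'(2)] w'(3)] k w'(1) by auto
  moreover have "seq w k = ?f k"
    using step_agree[OF w'(2) valid_fits[OF w'(2)] w'(3)] k \<open>k \<noteq> ?i\<close> w'(1)
    unfolding agree_off_def by metis
  ultimately show False using f_inj k dir_less unfolding inj_on_def by (metis lessThan_iff)
qed

text \<open>For a non-injective sequence, two labels are near at some index bound by a diagonal, and (Ax6) makes them equal. An
injective one comes from only one path and one permutation.\<close>
lemma twist_unique:
  assumes w: "valid w" and v: "valid v" and eq: "seq w \<circ> turn s = seq v \<circ> turn t"
  shows "twist (lab w) (turn s) = twist (lab v) (turn t)"
proof (cases "inj_on (seq w \<circ> turn s) {..<n}")
  case True
  have same: "seq w ` {..<n} = seq v ` {..<n}" using eq turn_image_seq by metis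
  have inj: "inj_on (seq w) {..<n}" "inj_on (seq v) {..<n}"
    using True eq turn_image by (metis inj_on_imageI)+
  have "v = w"
    using injective_path_unique[OF w v _ inj(1)] injective_path_unique[OF v w _ inj(2)] same
    by (metis nle_le)
  have "turn s k = turn t k" for k
  proof (cases "k < n")
    case True
    have "seq w (turn s k) = seq w (turn t k)" using eq \<open>v = w\<close> by (metis comp_apply)
    then show ?thesis using inj(1) True by (simp add: inj_on_def)
  next
    case False
    then show ?thesis using permutes_not_in[OF turn_permutes] by simp
  qed
  then have "turn s = turn t" ..
  then show ?thesis using \<open>v = w\<close> by simp
next
  case False
  let ?f = "seq w \<circ> turn s" and ?a = "twist (lab w) (turn s)" and ?b = "twist (lab v) (turn t)"
  obtain k l where kl: "k < n" "l < n" "k \<noteq> l" "?f k = ?f l"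
    using False unfolding inj_on_def by blast
  have "near k ?a ?b" using near_if_agree[OF w v kl(1)] eq agree_off_refl by metis
  moreover have "d k l \<in> ?a" using twist_fits[OF w] kl unfolding fits_def by blast
  moreover have "d k l \<in> ?b" using twist_fits[OF v] kl unfolding eq fits_def by blast
  ultimately show ?thesis using near_diag_eq twist_ultra w v kl by blast
qed

section \<open>The representation\<close>
definition unit :: "(nat \<Rightarrow> 'a base) set" where
  "unit = {seq w \<circ> turn s | w s. valid w}"

definition label :: "(nat \<Rightarrow> 'a base) \<Rightarrow> 'a set" where
  "label f = (THE a. \<exists>w s. valid w \<and> f = seq w \<circ> turn s \<and> a = twist (lab w) (turn s))"

lemma label_eq:
  assumes "valid w"
  shows "label (seq w \<circ> turn s) = twist (lab w) (turn s)"
  unfolding label_def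
proof (rule the_equality)
  fix a assume "\<exists>v t. valid v \<and> seq w \<circ> turn s = seq v \<circ> turn t \<and> a = twist (lab v) (turn t)"
  then obtain v t where "valid v" "seq w \<circ> turn s = seq v \<circ> turn t" "a = twist (lab v) (turn t)"
    by (elim exE conjE)
  then show "a = twist (lab w) (turn s)" using twist_unique assms by metis
next
  show "\<exists>v t. valid v \<and> seq w \<circ> turn s = seq v \<circ> turn t \<and> twist (lab w) (turn s) = twist (lab v) (turn t)"
    using assms by blast
qed

lemma unitE:
  assumes "f \<in> unit"
  obtains w s where "valid w" "f = seq w \<circ> turn s" "label f = twist (lab w) (turn s)"
proof -
  from assms obtain w s where "f = seq w \<circ> turn s" "valid w" by (auto simp: unit_def)
  then show thesis using that label_eq by metis
qed

lemma path_in_unit: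
  assumes "valid w"
  shows "seq w \<in> unit" "label (seq w) = lab w"
proof -
  obtain s where s: "turn s = id" using turn_id by blast
  then have "seq w = seq w \<circ> turn s" by simp
  then show "seq w \<in> unit" using assms unfolding unit_def by blast
  show "label (seq w) = lab w" using label_eq[OF assms, of s] s twist_id valid_ultra assms by simp
qed

lemma unit_ext: "unit \<subseteq> {..<n} \<rightarrow>\<^sub>E UNIV"
  by (rule subsetI, erule unitE) (auto simp: PiE_iff extensional_def seq_extensional)

lemma label_ultra: "f \<in> unit \<Longrightarrow> ultra (label f)"
  by (elim unitE) (simp add: twist_ultra)

lemma label_fits: "f \<in> unit \<Longrightarrow> fits f (label f)"
  by (elim unitE) (simp add: twist_fits)

lemma label_near: "f \<in> unit \<Longrightarrow> g \<in> unit \<Longrightarrow> i < n \<Longrightarrow> agree_off n i f g \<Longrightarrow> near i (label f) (label g)"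
  by (elim unitE) (simp add: near_if_agree)

lemma label_exists: "ultra a \<Longrightarrow> \<exists>f\<in>unit. label f = a"
  using path_in_unit[OF valid.root] by fastforce

lemma unit_extend:
  assumes f: "f \<in> unit" and i: "i < n" and b: "ultra b" and near: "near i (label f) b"
  shows "\<exists>g\<in>unit. agree_off n i f g \<and> label g = b"
proof (cases "b = label f")
  case True
  then show ?thesis using f agree_off_refl by blast
next
  case False
  obtain w s where w: "valid w" "f = seq w \<circ> turn s" "label f = twist (lab w) (turn s)"
    using unitE[OF f] .
  obtain t where t: "dir t = i" "turn t = turn s" using code[OF i] by blast
  have ok: "step_ok b t w" using b near False w t by (simp add: step_ok_def)
  then have "valid ((b, t) # w)" using w valid.step by blast
  moreover have "agree_off n i f (seq ((b, t) # w))"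
    using step_agree[OF w(1) valid_fits[OF w(1)] ok] w t by simp
  ultimately show ?thesis using path_in_unit by fastforce
qed

lemma unit_comp_turn: "f \<in> unit \<Longrightarrow> f \<circ> turn s \<in> unit"
proof (elim unitE)
  fix w t assume "valid w" "f = seq w \<circ> turn t"
  moreover obtain u where "turn u = turn t \<circ> turn s" using turn_comp by blast
  ultimately show ?thesis unfolding unit_def by (auto simp: comp_assoc) metis
qed

lemma unit_nonempty: "unit \<noteq> {}"
  using ultra_separates[of "one A" "zero A"] le_zero zero_neq_one label_exists
  by (metis closed(1,2) empty_iff)

lemma unit_represents: "represents n A unit (\<lambda>x. {f \<in> unit. x \<in> label f})"
    (is "represents n A unit ?h")
proof -
  have inj: "x \<sqsubseteq> y" if xy: "x \<in> C" "y \<in> C" "?h x \<subseteq> ?h y" for x y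
  proof (rule ccontr)
    assume "\<not> x \<sqsubseteq> y"
    then obtain U where U: "ultra U" "x \<in> U" "y \<notin> U" using ultra_separates[OF xy(1,2)] by blast
    then obtain f where "f \<in> unit" "label f = U" using label_exists by blast
    then show False using U xy(3) by blast
  qed
  have "inj_on ?h C"
  proof (rule inj_onI)
    fix x y assume xy: "x \<in> C" "y \<in> C" "?h x = ?h y"
    then have "x \<sqsubseteq> y" "y \<sqsubseteq> x" using inj by simp_all
    then show "x = y" using xy meet_commute by (simp add: leq_def)
  qed
  moreover have "x \<squnion> y \<in> label f \<longleftrightarrow> x \<in> label f \<or> y \<in> label f"
    "x \<sqinter> y \<in> label f \<longleftrightarrow> x \<in> label f \<and> y \<in> label f" "compl A x \<in> label f \<longleftrightarrow> x \<notin> label f"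
    if "f \<in> unit" "x \<in> C" "y \<in> C" for x y f
    using that label_ultra ultra_join_iff ultra_meet_iff ultra_compl_iff by blast+
  moreover have "zero A \<notin> label f" "one A \<in> label f" if "f \<in> unit" for f
    using label_ultra[OF that] ultra_zero ultra_one by blast+
  moreover have "f i = f j \<longleftrightarrow> d i j \<in> label f" if "f \<in> unit" "i < n" "j < n" for f i j
    using label_fits[OF that(1)] that by (simp add: fits_def)
  moreover have "cyl A i x \<in> label f \<longleftrightarrow> (\<exists>g\<in>unit. x \<in> label g \<and> agree_off n i f g)"
    if f: "f \<in> unit" and i: "i < n" and x: "x \<in> C" for f i x
  proof
    assume "cyl A i x \<in> label f"
    then obtain b where b: "ultra b" "x \<in> b" "near i b (label f)"
      using near_witness label_ultra[OF f] i x by blast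
    then have "near i (label f) b" using near_sym label_ultra[OF f] i by blast
    then show "\<exists>g\<in>unit. x \<in> label g \<and> agree_off n i f g"
      using unit_extend[OF f i b(1)] b(2) by blast
  next
    assume "\<exists>g\<in>unit. x \<in> label g \<and> agree_off n i f g"
    then show "cyl A i x \<in> label f"
      using label_near f i agree_off_sym unfolding near_def by blast
  qed
  ultimately show ?thesis unfolding represents_def by auto
qed

text \<open>By (Ax9) with equal outer indices, \<open>c\<^sub>i d\<^sub>i\<^sub>j = 1\<close>. So some sequence in the unit that agrees with \<open>f\<close> off \<open>i\<close> has
equal entries at \<open>i\<close> and \<open>j\<close>, and this can only be \<open>f \<circ> [i/j]\<close>.\<close>
lemma unit_diagonalizable:
  assumes ax9: "ax9 n A"
  shows "diagonalizable n unit"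
  unfolding diagonalizable_def
proof (intro ballI allI impI)
  fix f i j assume f: "f \<in> unit" and ij: "i < n" "j < n"
  show "f \<circ> repl i j \<in> unit"
  proof (cases "i = j")
    case True
    then have "repl i j = id" by (auto simp: repl_def)
    then show ?thesis using f by simp
  next
    case False
    have "d j j = cyl A i (d j i \<sqinter> d i j)" using ax9 ij False unfolding ax9_def by blast
    then have "cyl A i (d j i \<sqinter> d i j) \<in> label f" using diag_refl[OF label_ultra[OF f] ij(2)] by simp
    moreover have "d j i \<sqinter> d i j \<in> C" using ij by simp
    ultimately obtain b where b: "ultra b" "d j i \<sqinter> d i j \<in> b" "near i b (label f)"
      using near_witness[OF label_ultra[OF f] ij(1)] by metis
    then have "near i (label f) b" using near_sym label_ultra[OF f] ij by blast
    then obtain g where g: "g \<in> unit" "agree_off n i f g" "label g = b"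
      using unit_extend[OF f ij(1) b(1)] by blast
    have "d i j \<in> b" using b ultra_meet_iff ij by simp
    then have "g i = g j" using label_fits[OF g(1)] g(3) ij by (simp add: fits_def)
    then have "(f \<circ> repl i j) k = g k" if "k < n" for k
      using g(2) that ij False by (auto simp: repl_def agree_off_def)
    moreover have "f \<circ> repl i j \<in> {..<n} \<rightarrow>\<^sub>E UNIV"
      using subsetD[OF unit_ext f] ij by (auto simp: PiE_iff extensional_def repl_def)
    ultimately have "f \<circ> repl i j = g"
      using subsetD[OF unit_ext g(1)] by (metis PiE_ext lessThan_iff)
    then show ?thesis using g by simp
  qed
qed

end

lemma RC_tree:
  assumes "2 \<le> n" "A \<in> RC n"
  shows "rc_tree n A (\<lambda>s. if s < n then s else 0) (\<lambda>s. id) (\<lambda>a \<pi>. a)"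
proof -
  interpret rc_algebra n A using assms by unfold_locales
  show ?thesis
  proof unfold_locales
    show "\<exists>t. (if t < n then t else 0) = i \<and> id = id" if "i < n" for i
      using that by (intro exI[of _ i]) simp
  qed (use dim in \<open>auto simp: permutes_id intro: link.id\<close>)
qed

text \<open>The permutations are enumerated, and for each ultrafilter and permutation one linked ultrafilter is chosen.
The identity must keep the label, so that every ultrafilter near the label of \<open>f\<close> becomes the label of a
sequence.\<close>
lemma SC_tree:
  assumes n: "2 \<le> n" and A: "A \<in> SC n"
  obtains dir turn twist where "rc_tree n A dir turn twist" "range turn = {\<pi>. \<pi> permutes {..<n}}"
proof -
  have DC: "A \<in> DC n" using A by (simp add: SC_def)
  interpret rc_algebra n A using n DC by unfold_locales (auto simp: DC_def)
  have swaps: "\<exists>b. swap i j a b" if "ultra a" "i < n" "j < n" "i \<noteq> j" for a i j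
  proof (cases "n = 2")
    case True
    then show ?thesis using swap_exists_dim_2 that A by (simp add: SC_def)
  next
    case False
    then show ?thesis using swap_exists_dim_ge_3 that A n by (simp add: SC_def)
  qed
  define P where "P = {\<pi>::nat \<Rightarrow> nat. \<pi> permutes {..<n}}"
  have id: "id \<in> P" by (simp add: P_def permutes_id)
  have "countable P" unfolding P_def by (intro countable_finite finite_permutations) simp
  then have P: "range (from_nat_into P) = P" using id by (intro range_from_nat_into) auto
  define dir where "dir s = (if fst (prod_decode s) < n then fst (prod_decode s) else 0)" for s
  define turn where "turn s = from_nat_into P (snd (prod_decode s))" for s
  define twist where "twist a \<pi> = (if \<pi> = id then a else SOME b. link a \<pi> b)" for a \<pi>
  have turn_code: "\<exists>s. dir s = i \<and> turn s = \<pi>" if i: "i < n" and \<pi>: "\<pi> \<in> P" for i \<pi>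
  proof -
    obtain p where "from_nat_into P p = \<pi>" using from_nat_into_surj[OF \<open>countable P\<close> \<pi>] by blast
    then show ?thesis
      using i by (intro exI[of _ "prod_encode (i, p)"]) (simp add: dir_def turn_def)
  qed
  have turn_in: "turn s \<in> P" for s using P by (auto simp: turn_def)
  have range: "range turn = P"
  proof
    show "P \<subseteq> range turn" using turn_code[of 0] n by fastforce
  qed (use turn_in in blast)
  have "rc_tree n A dir turn twist"
  proof unfold_locales
    show "dir s < n" for s using n by (simp add: dir_def)
    show "\<exists>t. dir t = i \<and> turn t = turn s" if "i < n" for i s using turn_code[OF that turn_in] .
    show "\<exists>s. turn s = id" using turn_code[OF _ id, of 0] n by auto
    show "turn s permutes {..<n}" for s using turn_in by (simp add: P_def)
    show "\<exists>u. turn u = turn s \<circ> turn t" for s t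
    proof -
      have "turn s permutes {..<n}" "turn t permutes {..<n}" using turn_in by (simp_all add: P_def)
      then have "turn s \<circ> turn t \<in> P" using permutes_compose[of "turn t" _ "turn s"] by (simp add: P_def)
      then show ?thesis using turn_code[of 0] n by auto
    qed
    show "link a (turn s) (twist a (turn s))" if "ultra a" for a s
    proof (cases "turn s = id")
      case True
      then show ?thesis by (simp add: twist_def link.id)
    next
      case False
      have "turn s permutes {..<n}" using turn_in by (simp add: P_def)
      then have "\<exists>b. link a (turn s) b" using link_exists[OF swaps _ that] by simp
      then show ?thesis using False by (simp add: twist_def someI_ex)
    qed
    show "twist a id = a" for a by (simp add: twist_def)
  qed
  then show ?thesis using that range unfolding P_def by blast
qed

lemma RC_sound:
  fixes A :: "'a cyl_alg"
  assumes "A \<in> iso_copies n (RCs n :: 'u set_alg set)"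
  shows "A \<in> RC n"
proof -
  obtain V :: "(nat \<Rightarrow> 'u) set" and h where "algebra n A" "V \<noteq> {}" "V \<subseteq> {..<n} \<rightarrow>\<^sub>E UNIV" "represents n A V h"
    using assms unfolding iso_copies_RCs_iff by (elim conjE exE)
  then interpret represented n A V h by unfold_locales
  show ?thesis by (rule RC)
qed

lemma DC_sound:
  fixes A :: "'a cyl_alg"
  assumes "A \<in> iso_copies n (DCs n :: 'u set_alg set)"
  shows "A \<in> DC n"
proof -
  obtain V :: "(nat \<Rightarrow> 'u) set" and h where "algebra n A" "V \<noteq> {}" "V \<subseteq> {..<n} \<rightarrow>\<^sub>E UNIV" "diagonalizable n V" "represents n A V h"
    using assms unfolding iso_copies_DCs_iff by (elim conjE exE)
  then interpret diag_represented n A V h by unfold_locales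
  show ?thesis by (rule DC)
qed

lemma SC_sound:
  fixes A :: "'a cyl_alg"
  assumes "A \<in> iso_copies n (SCs n :: 'u set_alg set)"
  shows "A \<in> SC n"
proof -
  obtain V :: "(nat \<Rightarrow> 'u) set" and h where "algebra n A" "V \<noteq> {}" "V \<subseteq> {..<n} \<rightarrow>\<^sub>E UNIV"
    "diagonalizable n V" "permutable n V" "represents n A V h"
    using assms unfolding iso_copies_SCs_iff by (elim conjE exE)
  then interpret perm_represented n A V h by unfold_locales
  show ?thesis by (rule SC)
qed

lemma RC_complete:
  fixes A :: "'a cyl_alg"
  assumes "2 \<le> n" "A \<in> RC n"
  shows "A \<in> iso_copies n (RCs n :: 'a base set_alg set)"
proof -
  interpret rc_tree n A "\<lambda>s. if s < n then s else 0" "\<lambda>s. id" "\<lambda>a \<pi>. a"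
    using RC_tree assms .
  show ?thesis
    unfolding iso_copies_RCs_iff
    by (intro conjI exI) (rule alg unit_nonempty unit_ext unit_represents)+
qed

lemma DC_complete:
  fixes A :: "'a cyl_alg"
  assumes "2 \<le> n" "A \<in> DC n"
  shows "A \<in> iso_copies n (DCs n :: 'a base set_alg set)"
proof -
  have "A \<in> RC n" "ax9 n A" using assms(2) by (simp_all add: DC_def)
  then interpret rc_tree n A "\<lambda>s. if s < n then s else 0" "\<lambda>s. id" "\<lambda>a \<pi>. a"
    using RC_tree assms(1) by blast
  show ?thesis
    unfolding iso_copies_DCs_iff
    by (intro conjI exI)
      (rule alg unit_nonempty unit_ext unit_diagonalizable[OF \<open>ax9 n A\<close>] unit_represents)+
qed

lemma SC_complete:
  fixes A :: "'a cyl_alg"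
  assumes "2 \<le> n" "A \<in> SC n"
  shows "A \<in> iso_copies n (SCs n :: 'a base set_alg set)"
proof -
  have "ax9 n A" using assms(2) by (simp add: SC_def DC_def)
  obtain dir turn twist where tree: "rc_tree n A dir turn twist"
    and range: "range turn = {\<pi>. \<pi> permutes {..<n}}"
    using SC_tree assms .
  interpret rc_tree n A dir turn twist using tree .
  have "f \<circ> transpose i j \<in> unit" if "f \<in> unit" "i < n" "j < n" for f i j
  proof -
    have "transpose i j permutes {..<n}" using that by (intro permutes_swap_id) auto
    then obtain s where "transpose i j = turn s" using range by (metis imageE mem_Collect_eq)
    then show ?thesis using unit_comp_turn that(1) by simp
  qed
  then have "permutable n unit" by (simp add: permutable_def)
  show ?thesis
    unfolding iso_copies_SCs_iff
    by (intro conjI exI)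
      (rule alg unit_nonempty unit_ext unit_diagonalizable[OF \<open>ax9 n A\<close>] unit_represents \<open>permutable n unit\<close>)+
qed

theorem theorem1:
  fixes n :: nat
  assumes "n \<ge> 2"
  shows
    "(RC n :: 'a cyl_alg set) = iso_copies n (RCs n :: 'a base set_alg set) \<and>
     (iso_copies n (RCs n :: 'u set_alg set) :: 'a cyl_alg set) \<subseteq> RC n \<and>
     (DC n :: 'a cyl_alg set) = iso_copies n (DCs n :: 'a base set_alg set) \<and>
     (iso_copies n (DCs n :: 'u set_alg set) :: 'a cyl_alg set) \<subseteq> DC n \<and>
     (SC n :: 'a cyl_alg set) = iso_copies n (SCs n :: 'a base set_alg set) \<and>
     (iso_copies n (SCs n :: 'u set_alg set) :: 'a cyl_alg set) \<subseteq> SC n"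
  by (intro conjI subset_antisym subsetI)
    (erule RC_sound RC_complete[OF assms] DC_sound DC_complete[OF assms]
      SC_sound SC_complete[OF assms])+

end
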